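(* For every integer $r\geq 3$, there exists $n_1\in\mathbb{N}$ such that for all integers $n\geq n_1$ and every proper subset $A\subsetneq [n]$, we have $g_r(A)<g_r([n])$.
   Context: $[n]=\{1,2,\ldots,n\}$. A 3-term arithmetic progression (3-AP) of $A\subseteq[n]$ is a sequence $a, a+d, a+2d$ of elements of $A$ with $d\in[n]$ (so $d\ge 1$). An $r$-coloring of $A$ is any map $c\colon A\to[r]$ (not necessarily surjective). A 3-AP of $A$ is rainbow under $c$ if its three terms have pairwise distinct colors; $c$ is rainbow 3-AP-free if no 3-AP of $A$ is rainbow. $g_r(A)$ denotes the number of rainbow 3-AP-free $r$-colorings of $A$. *)

theory Defs
  imports Main "HOL-Library.FuncSet"
begin

(* The progression a, a + d, a + 2d is encoded by the pair (a, d). For A \<subseteq> {1..n} the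
   membership conditions force d < n, so the restriction d \<in> {1..n} reduces to d \<ge> 1. *)
definition is_3AP :: "nat set \<Rightarrow> nat \<Rightarrow> nat \<Rightarrow> bool" where
  "is_3AP A a d \<longleftrightarrow> 1 \<le> d \<and> a \<in> A \<and> a + d \<in> A \<and> a + 2 * d \<in> A"

(* Extensional functions, so that each map A \<rightarrow> {1..r} is represented exactly once. *)
definition colorings :: "nat \<Rightarrow> nat set \<Rightarrow> (nat \<Rightarrow> nat) set" where
  "colorings r A = A \<rightarrow>\<^sub>E {1..r}"

definition rainbow_3AP :: "(nat \<Rightarrow> nat) \<Rightarrow> nat \<Rightarrow> nat \<Rightarrow> bool" where
  "rainbow_3AP c a d \<longleftrightarrow>
     c a \<noteq> c (a + d) \<and> c (a + d) \<noteq> c (a + 2 * d) \<and> c a \<noteq> c (a + 2 * d)"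

definition rainbow_3AP_free :: "nat set \<Rightarrow> (nat \<Rightarrow> nat) \<Rightarrow> bool" where
  "rainbow_3AP_free A c \<longleftrightarrow> (\<forall>a d. is_3AP A a d \<longrightarrow> \<not> rainbow_3AP c a d)"

definition num_rainbow_free :: "nat \<Rightarrow> nat set \<Rightarrow> nat" where
  "num_rainbow_free r A = card {c \<in> colorings r A. rainbow_3AP_free A c}"

end

theory Submission
  imports Complex_Main Defs
begin

text \<open>Colour a random sparse set \<open>S\<close> as prescribed by a rainbow-free colouring \<open>c\<close>. A pair
  \<open>x - d, x + d \<in> S\<close> with two colours leaves at most these two colours for \<open>x\<close>. A point \<open>x\<close> for
  which \<open>S\<close> contains no such pair has almost only monochromatic symmetric pairs; by
  Varnavides' strengthening of Roth's theorem such points span many progressions, and a bounded number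
  of further sampled colours predicts \<open>c\<close> on almost all of them. So there are only \<open>2\<close> to the
  \<open>o(n)\<close> assignments of lists of at most two colours such that every rainbow-free colouring of \<open>A\<close>
  chooses from one of them. For a fixed assignment, exponentially few of these \<open>2\<close> to the \<open>n\<close>
  choices are rainbow-free with three colours: either many points have a short list, or there are many
  disjoint progressions whose lists differ, or almost all lists agree, and then a point with a third colour
  forces linearly many disjoint equalities. Hence two-coloured colourings dominate, and there are at
  most half as many of them on a proper subset as on \<open>{1..n}\<close>.\<close>

section \<open>Roth and Varnavides\<close>

text \<open>Every estimate is measured against \<open>2 ^ n\<close>, never against
  \<open>2 ^ card A\<close>, so small and large \<open>A\<close> are treated alike, and a bound of a
  small multiple of \<open>2 ^ n\<close> on three-coloured colourings is enough. Lists of two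
  colours are the right target: their choices number at most \<open>2 ^ n\<close>, the order of the
  main term, so a constant factor saved at each of linearly many disjoint places beats a
  sufficiently small exponential number of assignments.

  The obstacle is a point that no sampled pair restricts. One progression among such points, as
  Roth's theorem gives, would be too little to predict colours. Quadratically many progressions give
  one point linked to linearly many others through midpoints. After boundedly many such choices
  almost no suitable points remain undominated, and recording boundedly many colours costs nothing
  on the exponential scale.

  Roth's theorem is obtained from Szemeredi's cube argument, run at the infimum of the extremal
  densities: no progression-free set can be much denser than this infimum on windows, so one that
  avoids a large structured set is too small.\<close>

text \<open>Cut every maximal run of step \<open>D\<close> in \<open>P\<close> into windows of
  length \<open>m\<close>. Full windows obey the density bound; fewer than \<open>m\<close> points
  of each run are left over, and they are charged to the first point of the run, counted in the last
  summand.\<close>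

lemma card_le_by_windows:
  fixes \<theta> :: real and m D :: nat
  assumes "finite P" "D \<ge> 1" "\<theta> \<ge> 0" "m \<ge> 1"
    and "\<And>a. (\<lambda>i. a + i * D) ` {..<m} \<subseteq> P \<Longrightarrow>
           real (card (A \<inter> (\<lambda>i. a + i * D) ` {..<m})) \<le> \<theta> * real m"
  shows "real (card (A \<inter> P)) \<le> \<theta> * real (card P) + real m * real (card {y\<in>P. y < D \<or> y - D \<notin> P})"
  using assms(1,5)
proof (induction "card P" arbitrary: P rule: less_induct)
  case less
  let ?st = "\<lambda>P. {y\<in>P. y < D \<or> y - D \<notin> P}"
  show ?case
  proof (cases "P = {}")
    case True
    then show ?thesis by simp
  next
    case False
    define y where "y = Min P"
    have yP: "y \<in> P" and ymin: "\<And>z. z \<in> P \<Longrightarrow> y \<le> z"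
      using less.prems(1) False by (auto simp: y_def)
    have yst: "y \<in> ?st P"
      using yP ymin[of "y - D"] \<open>D \<ge> 1\<close> by (cases "y < D") auto
    let ?w = "\<lambda>l. (\<lambda>i. y + i * D) ` {..<l}"
    have inj: "inj_on (\<lambda>i. y + i * D) X" for X
      using \<open>D \<ge> 1\<close> by (auto simp: inj_on_def)
    have cardw: "card (?w l) = l" for l
      using card_image[OF inj] by simp
    have split: "card (A \<inter> P) = card (A \<inter> ?w l) + card (A \<inter> (P - ?w l))" if "?w l \<subseteq> P" for l
    proof -
      have "A \<inter> P = (A \<inter> ?w l) \<union> (A \<inter> (P - ?w l))" using that by auto
      then show ?thesis
        using less.prems(1) by (metis card_Un_disjoint Diff_disjoint finite_Diff finite_Int
            finite_imageI finite_lessThan inf_assoc inf_bot_right inf_left_commute)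
    qed
    have finst: "finite (?st P)" using less.prems(1) by auto
    show ?thesis
    proof (cases "?w m \<subseteq> P")
      case True
      let ?Q = "P - ?w m"
      have cQ: "card ?Q = card P - m" and mP: "m \<le> card P"
        using True cardw less.prems(1) by (auto simp: card_Diff_subset card_mono intro: order.trans[OF _ card_mono[of P "?w m"]])
      have lt: "card ?Q < card P" using cQ mP \<open>m \<ge> 1\<close> by simp
      \<comment> \<open>Deleting a full window moves the first point of its run from
        \<open>y\<close> to \<open>y + m * D\<close>, or ends the run, so the number of first points
        does not grow.\<close>
      have sub: "?st ?Q \<subseteq> (?st P - {y}) \<union> {y + m * D}"
      proof
        fix z assume z: "z \<in> ?st ?Q"
        have "z \<noteq> y" using z \<open>m \<ge> 1\<close> by force
        moreover have "z = y + m * D" if "z \<notin> ?st P"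
        proof -
          from that z have "z \<ge> D" "z - D \<in> ?w m" by auto
          then obtain i where i: "i < m" "z - D = y + i * D" by auto
          then have zi: "z = y + Suc i * D" using \<open>z \<ge> D\<close> by simp
          have "\<not> Suc i < m" using z zi by blast
          then have "Suc i = m" using i by simp
          then show ?thesis using zi by simp
        qed
        ultimately show "z \<in> (?st P - {y}) \<union> {y + m * D}" by blast
      qed
      have "card (?st ?Q) \<le> card ((?st P - {y}) \<union> {y + m * D})"
        by (rule card_mono[OF _ sub]) (use finst in auto)
      also have "\<dots> \<le> card (?st P - {y}) + 1"
        by (rule order.trans[OF card_Un_le]) simp
      also have "\<dots> = card (?st P)"
        using card_Suc_Diff1[OF finst yst] by simp
      finally have st: "card (?st ?Q) \<le> card (?st P)" .
      have IH: "real (card (A \<inter> ?Q)) \<le> \<theta> * real (card ?Q) + real m * real (card (?st ?Q))"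
        using less.hyps[OF lt] less.prems by blast
      have "real m * real (card (?st ?Q)) \<le> real m * real (card (?st P))"
        using st by (intro mult_left_mono) auto
      moreover have "real (card (A \<inter> ?w m)) \<le> \<theta> * real m"
        using less.prems(2)[OF True] .
      moreover have "\<theta> * real (card ?Q) + \<theta> * real m = \<theta> * real (card P)"
        using cQ mP by (simp add: of_nat_diff algebra_simps)
      ultimately show ?thesis using IH split[OF True] by simp
    next
      case False
      then obtain l0 where "l0 < m" "y + l0 * D \<notin> P" by auto
      define l where "l = (LEAST l. y + l * D \<notin> P)"
      have l: "y + l * D \<notin> P" unfolding l_def using \<open>y + l0 * D \<notin> P\<close> by (rule LeastI)
      have "l \<le> l0" unfolding l_def using \<open>y + l0 * D \<notin> P\<close> by (rule Least_le)
      then have lm: "l < m" using \<open>l0 < m\<close> by simp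
      have wP: "?w l \<subseteq> P" using not_less_Least[of _ "\<lambda>l. y + l * D \<notin> P"] by (auto simp: l_def)
      have l1: "l \<ge> 1" using l yP by (cases l) auto
      let ?Q = "P - ?w l"
      have cQ: "card ?Q = card P - l" and lP: "l \<le> card P"
        using wP cardw less.prems(1) by (auto simp: card_Diff_subset card_mono intro: order.trans[OF _ card_mono[of P "?w l"]])
      have lt: "card ?Q < card P" using cQ lP l1 by simp
      \<comment> \<open>Here the window is cut short by the end of the run. The whole run goes, and
        its first point \<open>y\<close> pays for these \<open>l < m\<close> points.\<close>
      have sub: "?st ?Q \<subseteq> ?st P - {y}"
      proof
        fix z assume z: "z \<in> ?st ?Q"
        have "z \<noteq> y" using z l1 by force
        moreover have False if "z \<notin> ?st P"
        proof -
          from that z have "z \<ge> D" "z - D \<in> ?w l" by auto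
          then obtain i where i: "i < l" "z - D = y + i * D" by auto
          then have zi: "z = y + Suc i * D" using \<open>z \<ge> D\<close> by simp
          have "\<not> Suc i < l" using z zi by blast
          then have "Suc i = l" using i by simp
          then show ?thesis using zi l z by auto
        qed
        ultimately show "z \<in> ?st P - {y}" by blast
      qed
      have "card (?st ?Q) + 1 \<le> card (?st P)"
        using card_mono[OF _ sub] finst card_Suc_Diff1[OF finst yst] by simp
      then have st: "real (card (?st ?Q)) + 1 \<le> real (card (?st P))" by linarith
      have IH: "real (card (A \<inter> ?Q)) \<le> \<theta> * real (card ?Q) + real m * real (card (?st ?Q))"
        using less.hyps[OF lt] less.prems by blast
      have "real m * (real (card (?st ?Q)) + 1) \<le> real m * real (card (?st P))"
        using st by (intro mult_left_mono) auto
      moreover have "card (A \<inter> ?w l) \<le> card (?w l)" by (rule card_mono) auto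
      then have "real (card (A \<inter> ?w l)) \<le> real m" using cardw lm by simp
      moreover have "\<theta> * real (card ?Q) \<le> \<theta> * real (card P)"
        using cQ \<open>\<theta> \<ge> 0\<close> by (intro mult_left_mono) auto
      ultimately show ?thesis using IH split[OF wP] by (simp add: algebra_simps)
    qed
  qed
qed

section \<open>Hilbert cubes in dense sets\<close>

fun cube :: "nat \<Rightarrow> nat list \<Rightarrow> nat set" where
  "cube a [] = {a}"
| "cube a (d # ds) = cube a ds \<union> (\<lambda>x. x + d) ` cube a ds"

text \<open>Suffixes of the generator list describe faces with the same base point. The recursion
  consumes the head, so these faces form an increasing chain, along which reflections are compared
  later.\<close>

lemma cube_append_subset: "cube a es \<subseteq> cube a (pre @ es)"
  by (induction pre) auto

lemma base_in_cube: "a \<in> cube a ds"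
  by (induction ds) auto

lemma card_less_pairs:
  fixes X :: "'a :: linorder set"
  assumes "finite X"
  shows "2 * card {(x, y). x \<in> X \<and> y \<in> X \<and> x < y} + card X = card X * card X"
proof -
  let ?L = "{(x, y). x \<in> X \<and> y \<in> X \<and> x < y}"
  let ?G = "prod.swap ` ?L"
  let ?D = "(\<lambda>x. (x, x)) ` X"
  have fin: "finite ?L" by (rule finite_subset[of _ "X \<times> X"]) (use assms in auto)
  have eq: "X \<times> X = (?L \<union> ?G) \<union> ?D"
  proof (intro equalityI subsetI)
    fix p assume "p \<in> X \<times> X"
    then obtain x y where p: "p = (x, y)" "x \<in> X" "y \<in> X" by auto
    consider "x < y" | "y < x" | "x = y" by fastforce
    then show "p \<in> (?L \<union> ?G) \<union> ?D"
    proof cases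
      case 2
      then have "(y, x) \<in> ?L" using p by auto
      then have "prod.swap (y, x) \<in> ?G" by blast
      then show ?thesis using p by simp
    qed (use p in auto)
  qed auto
  have "card (X \<times> X) = card (?L \<union> ?G) + card ?D"
    unfolding eq by (rule card_Un_disjoint) (use assms fin in auto)
  also have "card (?L \<union> ?G) = card ?L + card ?G"
    by (rule card_Un_disjoint) (use fin in auto)
  also have "card ?G = card ?L" by (rule card_image) simp
  also have "card ?D = card X" by (rule card_image) (simp add: inj_on_def)
  finally show ?thesis by (simp add: card_cartesian_product)
qed

text \<open>Pigeonhole on differences: the pairs in \<open>X\<close> number at least a quarter of
  the square of \<open>card X\<close>, as \<open>card X \<ge> 2\<close>, and they have fewer than
  \<open>B\<close> possible differences.\<close>

lemma dense_shift_intersection: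
  fixes \<sigma> :: real
  assumes X: "(X :: nat set) \<subseteq> {s..<s + B}" and dens: "real (card X) \<ge> \<sigma> * real B" and two: "card X \<ge> 2" and "\<sigma> > 0"
  shows "\<exists>d. 1 \<le> d \<and> d < B \<and> real (card {x\<in>X. x + d \<in> X}) \<ge> \<sigma>\<^sup>2 / 4 * real B"
proof (rule ccontr)
  assume "\<not> ?thesis"
  then have small: "real (card {x\<in>X. x + d \<in> X}) < \<sigma>\<^sup>2 / 4 * real B" if "1 \<le> d" "d < B" for d
    using that by (meson not_le)
  have finX: "finite X" using X finite_subset by blast
  let ?L = "{(x, y). x \<in> X \<and> y \<in> X \<and> x < y}"
  let ?U = "\<Union>d\<in>{1..<B}. (\<lambda>x. (x, x + d)) ` {x\<in>X. x + d \<in> X}"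
  have "?L \<subseteq> ?U"
  proof
    fix p assume "p \<in> ?L"
    then obtain x y where p: "p = (x, y)" "x \<in> X" "y \<in> X" "x < y" by auto
    then have "x \<in> {s..<s + B}" "y \<in> {s..<s + B}" using X by auto
    then have "y - x \<in> {1..<B}" using p(4) by auto
    moreover have "p = (x, x + (y - x))" "x + (y - x) \<in> X" using p by auto
    ultimately show "p \<in> ?U" using p(2) by blast
  qed
  then have "card ?L \<le> card ?U"
    by (rule card_mono[rotated]) (use finX in auto)
  also have "\<dots> \<le> (\<Sum>d\<in>{1..<B}. card ((\<lambda>x. (x, x + d)) ` {x\<in>X. x + d \<in> X}))"
    by (rule card_UN_le) simp
  also have "\<dots> \<le> (\<Sum>d\<in>{1..<B}. card {x\<in>X. x + d \<in> X})"
    by (rule sum_mono, rule card_image_le) (use finX in auto)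
  finally have "real (card ?L) \<le> (\<Sum>d\<in>{1..<B}. real (card {x\<in>X. x + d \<in> X}))"
    by (metis (mono_tags, lifting) of_nat_le_iff of_nat_sum sum.cong)
  also have "\<dots> \<le> (\<Sum>d\<in>{1..<B}. \<sigma>\<^sup>2 / 4 * real B)"
    by (rule sum_mono) (use small in \<open>auto intro: less_imp_le\<close>)
  also have "\<dots> = real (B - 1) * (\<sigma>\<^sup>2 / 4 * real B)" by simp
  finally have 1: "real (card ?L) \<le> real (B - 1) * (\<sigma>\<^sup>2 / 4 * real B)" .
  have "B \<ge> 1"
    using two X by (cases B) auto
  have "real (B - 1) * (\<sigma>\<^sup>2 / 4 * real B) < real B * (\<sigma>\<^sup>2 / 4 * real B)"
    using \<open>B \<ge> 1\<close> \<open>\<sigma> > 0\<close> by (intro mult_strict_right_mono) auto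
  also have "\<dots> = (\<sigma> * real B)\<^sup>2 / 4" by (simp add: power2_eq_square)
  also have "\<dots> \<le> (real (card X))\<^sup>2 / 4"
    using dens \<open>\<sigma> > 0\<close> by (intro divide_right_mono power_mono) auto
  finally have 2: "real (card ?L) < (real (card X))\<^sup>2 / 4" using 1 by simp
  have "2 * real (card ?L) + real (card X) = (real (card X))\<^sup>2"
    using arg_cong[OF card_less_pairs[OF finX], of real] by (simp add: power2_eq_square)
  moreover have "(real (card X))\<^sup>2 \<ge> 2 * real (card X)"
    using two by (simp add: power2_eq_square)
  ultimately show False using 2 by linarith
qed

text \<open>Iterate the shift intersection: a cube among the points \<open>x\<close> with
  \<open>x\<close> and \<open>x + d\<close> in \<open>X\<close> doubles to a cube in
  \<open>X\<close>, while the density drops from \<open>\<sigma>\<close> to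
  \<open>\<sigma>\<^sup>2 / 4\<close>. The bound on the generators matters later, because it keeps a
  shift short compared with the whole interval.\<close>

lemma hilbert_cube:
  fixes \<sigma> :: real
  assumes "\<sigma> > 0"
  shows "\<exists>B0\<ge>1. \<forall>B\<ge>B0. \<forall>s. \<forall>X :: nat set. X \<subseteq> {s..<s + B} \<longrightarrow> real (card X) \<ge> \<sigma> * real B \<longrightarrow>
    (\<exists>a ds. length ds = k \<and> cube a ds \<subseteq> X \<and> (\<forall>d\<in>set ds. 1 \<le> d \<and> d < B))"
  using assms
proof (induction k arbitrary: \<sigma>)
  case 0
  show ?case
  proof (rule exI[of _ 1], intro conjI allI impI)
    fix B s :: nat and X :: "nat set" assume "1 \<le> B" "real (card X) \<ge> \<sigma> * real B"
    then have "real (card X) > 0" using mult_pos_pos[of \<sigma> "real B"] 0 by linarith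
    then have "X \<noteq> {}" by auto
    then obtain a where "a \<in> X" by blast
    then show "\<exists>a ds. length ds = 0 \<and> cube a ds \<subseteq> X \<and> (\<forall>d\<in>set ds. 1 \<le> d \<and> d < B)"
      by (intro exI[of _ a] exI[of _ "[]"]) auto
  qed simp
next
  case (Suc k)
  obtain B0 where B0: "B0 \<ge> 1" "\<And>B s X. B \<ge> B0 \<Longrightarrow> X \<subseteq> {s..<s + B} \<Longrightarrow>
      real (card X) \<ge> \<sigma>\<^sup>2 / 4 * real B \<Longrightarrow>
      \<exists>a ds. length ds = k \<and> cube a ds \<subseteq> X \<and> (\<forall>d\<in>set ds. 1 \<le> d \<and> d < B)"
    using Suc.IH[of "\<sigma>\<^sup>2 / 4"] Suc.prems by (metis divide_pos_pos zero_less_numeral zero_less_power)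
  show ?case
  \<comment> \<open>The second entry gives \<open>\<sigma> * B \<ge> 2\<close>, hence two points to
    start from.\<close>
  proof (rule exI[of _ "max B0 (nat \<lceil>2 / \<sigma>\<rceil>)"], intro conjI allI impI)
    show "1 \<le> max B0 (nat \<lceil>2 / \<sigma>\<rceil>)" using B0(1) by simp
  next
    fix B s :: nat and X :: "nat set"
    assume B: "max B0 (nat \<lceil>2 / \<sigma>\<rceil>) \<le> B" and X: "X \<subseteq> {s..<s + B}" and c: "real (card X) \<ge> \<sigma> * real B"
    have "2 / \<sigma> \<le> real B" using B by linarith
    then have "2 \<le> \<sigma> * real B" using Suc.prems by (simp add: field_simps)
    then have two: "card X \<ge> 2" using c by linarith
    obtain d where d: "1 \<le> d" "d < B" "real (card {x\<in>X. x + d \<in> X}) \<ge> \<sigma>\<^sup>2 / 4 * real B"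
      using dense_shift_intersection[OF X c two Suc.prems] by blast
    have "B0 \<le> B" "{x\<in>X. x + d \<in> X} \<subseteq> {s..<s + B}" using B X by auto
    from B0(2)[OF this d(3)] obtain a ds where
      a: "length ds = k" "cube a ds \<subseteq> {x\<in>X. x + d \<in> X}" "\<forall>d\<in>set ds. 1 \<le> d \<and> d < B" by blast
    show "\<exists>a ds. length ds = Suc k \<and> cube a ds \<subseteq> X \<and> (\<forall>d\<in>set ds. 1 \<le> d \<and> d < B)"
      by (intro exI[of _ a] exI[of _ "d # ds"]) (use a d in auto)
  qed
qed

section \<open>Extremal progression-free sets and Roth's theorem\<close>

definition ap3_free :: "nat set \<Rightarrow> bool" where
  "ap3_free X \<longleftrightarrow> (\<forall>a d. \<not> is_3AP X a d)"

definition roth_number :: "nat \<Rightarrow> nat" where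
  "roth_number n = Max (card ` {X. X \<subseteq> {..<n} \<and> ap3_free X})"

lemma ap3_free_empty: "ap3_free {}"
  by (simp add: ap3_free_def is_3AP_def)

lemma card_le_roth_number:
  assumes "X \<subseteq> {..<n}" "ap3_free X"
  shows "card X \<le> roth_number n"
  unfolding roth_number_def using assms by (intro Max_ge) auto

lemma ap3_free_of_card_roth_number:
  obtains X where "X \<subseteq> {..<n}" "ap3_free X" "card X = roth_number n"
proof -
  have "roth_number n \<in> card ` {X. X \<subseteq> {..<n} \<and> ap3_free X}"
    unfolding roth_number_def using ap3_free_empty by (intro Max_in) auto
  then show thesis using that by auto
qed

text \<open>Being progression-free is invariant under affine maps, so a window of any step behaves
  like an interval of \<open>m\<close> points.\<close>

lemma card_Int_window_le_roth_number:
  assumes "ap3_free A" "D \<ge> 1"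
  shows "card (A \<inter> (\<lambda>i. a + i * D) ` {..<m}) \<le> roth_number m"
proof -
  let ?f = "\<lambda>i. a + i * D"
  let ?X = "{i\<in>{..<m}. ?f i \<in> A}"
  have eq: "A \<inter> ?f ` {..<m} = ?f ` ?X" by auto
  have "card (?f ` ?X) \<le> card ?X" by (rule card_image_le) auto
  also have "\<dots> \<le> roth_number m"
  proof (rule card_le_roth_number)
    show "ap3_free ?X"
      unfolding ap3_free_def
    proof (intro allI notI)
      fix i j assume "is_3AP ?X i j"
      then have "is_3AP A (?f i) (j * D)"
        using \<open>D \<ge> 1\<close> by (auto simp: is_3AP_def algebra_simps)
      then show False using assms(1) by (auto simp: ap3_free_def)
    qed
  qed auto
  finally show ?thesis unfolding eq .
qed

text \<open>\<open>2 * q - x\<close> is the third term of the progression with first term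
  \<open>x\<close> and middle term \<open>q\<close>. Subtraction is truncated, but the definition is
  applied only where \<open>x \<le> q\<close>.\<close>

definition reflections :: "nat set \<Rightarrow> nat \<Rightarrow> nat list \<Rightarrow> nat set" where
  "reflections L a ds = {2 * q - x |q x. q \<in> cube a ds \<and> x \<in> L}"

text \<open>Moving \<open>q\<close> by \<open>d\<close> moves the reflection by
  \<open>2 * d\<close>; the hypothesis rules out truncated subtraction.\<close>

lemma reflections_Cons:
  assumes "\<And>q x. q \<in> cube a ds \<Longrightarrow> x \<in> L \<Longrightarrow> x \<le> q"
  shows "reflections L a (d # ds) = reflections L a ds \<union> (\<lambda>y. y + 2 * d) ` reflections L a ds"
proof -
  have *: "2 * (q + d) - x = 2 * q - x + 2 * d" if "q \<in> cube a ds" "x \<in> L" for q x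
    using assms[OF that] by simp
  show ?thesis
    unfolding reflections_def cube.simps
  proof (intro equalityI subsetI)
    fix z assume "z \<in> {2 * q - x |q x. q \<in> cube a ds \<union> (\<lambda>x. x + d) ` cube a ds \<and> x \<in> L}"
    then show "z \<in> {2 * q - x |q x. q \<in> cube a ds \<and> x \<in> L} \<union>
        (\<lambda>y. y + 2 * d) ` {2 * q - x |q x. q \<in> cube a ds \<and> x \<in> L}"
      using * by blast
  next
    fix z assume "z \<in> {2 * q - x |q x. q \<in> cube a ds \<and> x \<in> L} \<union>
        (\<lambda>y. y + 2 * d) ` {2 * q - x |q x. q \<in> cube a ds \<and> x \<in> L}"
    then show "z \<in> {2 * q - x |q x. q \<in> cube a ds \<union> (\<lambda>x. x + d) ` cube a ds \<and> x \<in> L}"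
      using *[symmetric] by blast
  qed
qed

text \<open>Telescoping over the suffixes of \<open>ds\<close>: the steps sum to less than
  \<open>length ds * g\<close>, so one of them is below \<open>g\<close>.\<close>

lemma exists_small_increment:
  fixes F :: "'a list \<Rightarrow> real" and g :: real
  assumes "F ds < F [] + real (length ds) * g"
  shows "\<exists>pre d es. ds = pre @ d # es \<and> F (d # es) < F es + g"
  using assms
proof (induction ds)
  case Nil
  then show ?case by simp
next
  case (Cons d ds)
  show ?case
  proof (cases "F (d # ds) < F ds + g")
    case True
    then show ?thesis by (intro exI[of _ "[]"]) auto
  next
    case False
    with Cons.prems have "F ds < F [] + real (length ds) * g" by (simp add: algebra_simps)
    from Cons.IH[OF this] obtain pre d' es where "ds = pre @ d' # es" "F (d' # es) < F es + g" by blast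
    then show ?thesis by (intro exI[of _ "d # pre"]) auto
  qed
qed

text \<open>The Szemeredi cube argument: reflecting the part of a free set \<open>A\<close> left of a cube
  \<open>M \<subseteq> A\<close> in the points of \<open>M\<close> gives a set disjoint from \<open>A\<close>. Along the faces of \<open>M\<close> these
  reflections increase, so one of them is almost invariant under a bounded shift, and its complement
  splits into long progressions.\<close>

lemma no_positive_roth_density:
  fixes c :: real
  assumes c: "c > 0" and lower: "\<And>n. n \<ge> 1 \<Longrightarrow> c * real n \<le> real (roth_number n)"
    and upper: "\<And>\<epsilon>. \<epsilon> > 0 \<Longrightarrow> \<exists>m\<ge>1. real (roth_number m) \<le> (c + \<epsilon>) * real m"
  shows False
proof -
  \<comment> \<open>Final balance in units of \<open>c\<^sup>2 * t\<close>: leaving out the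
    reflections gains 3, against losses of 1/2 for \<open>10 * \<epsilon> * t\<close>, 1/2 for
    \<open>m * g\<close> and less than 1 for \<open>2 * m * B\<close>.\<close>
  define \<epsilon> where "\<epsilon> = c\<^sup>2 / 20"
  have "\<epsilon> > 0" using c by (simp add: \<epsilon>_def)
  have c1: "c \<le> 1"
  proof -
    obtain X where "X \<subseteq> {..<1::nat}" "card X = roth_number 1"
      using ap3_free_of_card_roth_number by metis
    then have "roth_number 1 \<le> 1" by (metis card_mono card_lessThan finite_lessThan)
    then show ?thesis using lower[of 1] by simp
  qed
  have eps: "\<epsilon> \<le> c / 20" using c c1 by (simp add: \<epsilon>_def power2_eq_square)
  obtain m where m: "m \<ge> 1" "real (roth_number m) \<le> (c + \<epsilon>) * real m"
    using upper[OF \<open>\<epsilon> > 0\<close>] by blast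
  have window: "real (card (A \<inter> P)) \<le> (c + \<epsilon>) * real (card P) + real m * real (card {y\<in>P. y < D \<or> y - D \<notin> P})"
    if "ap3_free A" "finite P" "D \<ge> 1" for A P D
  proof (rule card_le_by_windows)
    fix a
    show "real (card (A \<inter> (\<lambda>i. a + i * D) ` {..<m})) \<le> (c + \<epsilon>) * real m"
      using card_Int_window_le_roth_number[OF that(1,3), of a m] m(2) by linarith
  qed (use that m c \<open>\<epsilon> > 0\<close> in auto)
  \<comment> \<open>The average growth per generator will be \<open>10 * t / k\<close>; this
    \<open>k\<close> keeps \<open>m\<close> times that growth at most
    \<open>c\<^sup>2 * t / 2\<close>.\<close>
  define k where "k = nat \<lceil>20 * real m / c\<^sup>2\<rceil>"
  have k: "real k \<ge> 20 * real m / c\<^sup>2" unfolding k_def by linarith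
  have kpos: "real k > 0" using k m(1) c by (smt (verit) divide_pos_pos of_nat_le_iff of_nat_1 zero_less_power)
  have "c / 4 > 0" using c by simp
  from hilbert_cube[OF this, of k] obtain B where B: "B \<ge> 1" and
    cb: "\<forall>B'\<ge>B. \<forall>s. \<forall>X. X \<subseteq> {s..<s + B'} \<longrightarrow> real (card X) \<ge> c / 4 * real B' \<longrightarrow>
      (\<exists>a ds. length ds = k \<and> cube a ds \<subseteq> X \<and> (\<forall>d\<in>set ds. 1 \<le> d \<and> d < B'))"
    by (elim exE conjE)
  note cube = cb[rule_format, OF order_refl]
  \<comment> \<open>Chosen last, since \<open>t\<close> depends on \<open>B\<close>,
    \<open>B\<close> on \<open>k\<close> and \<open>k\<close> on \<open>m\<close>. The three
    summands yield \<open>t1\<close>, \<open>t2\<close> and \<open>t3\<close>.\<close>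
  define t where "t = nat \<lceil>2 * real m * real B / c\<^sup>2 + 40 * real m / c + 5 * real B / c\<rceil> + 1"
  have t: "real t > 2 * real m * real B / c\<^sup>2 + 40 * real m / c + 5 * real B / c"
    unfolding t_def by linarith
  have nn: "0 \<le> 2 * real m * real B / c\<^sup>2" "0 \<le> 40 * real m / c" "0 \<le> 5 * real B / c" using c by auto
  have t1: "2 * real m * real B < c\<^sup>2 * real t" 
  proof -
    have "2 * real m * real B / c\<^sup>2 < real t" using t nn by linarith
    then show ?thesis using c by (simp add: field_simps)
  qed
  have t2: "40 * real m < c * real t"
  proof -
    have "40 * real m / c < real t" using t nn by linarith
    then show ?thesis using c by (simp add: field_simps)
  qed
  have t3: "5 * real B < c * real t"
  proof -
    have "5 * real B / c < real t" using t nn by linarith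
    then show ?thesis using c by (simp add: field_simps)
  qed
  have tpos: "real t > 0" by (simp add: t_def)
  have et: "\<epsilon> * real t \<le> c * real t / 20" using mult_right_mono[OF eps, of "real t"] by simp
  \<comment> \<open>The scale 10: with cube points in \<open>{4 * t..<5 * t}\<close> and reflected
    points below \<open>4 * t\<close>, every \<open>2 * q - x\<close> is positive and below
    \<open>10 * t\<close>.\<close>
  obtain A where A: "A \<subseteq> {..<10 * t}" "ap3_free A" "card A = roth_number (10 * t)"
    using ap3_free_of_card_roth_number by metis
  have finA: "finite A" using A(1) finite_subset by blast
  have cA: "real (card A) \<ge> 10 * c * real t" using lower[of "10 * t"] A(3) by (simp add: t_def algebra_simps)
  define L where "L = A \<inter> {..<4 * t}"
  have "card A = card L + card (A \<inter> {4 * t..<10 * t})"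
  proof -
    have "A = L \<union> (A \<inter> {4 * t..<10 * t})" using A(1) by (auto simp: L_def)
    then show ?thesis using finA
      by (metis (no_types, lifting) L_def Int_Un_distrib card_Un_disjoint disjoint_iff finite_Int
          IntD2 atLeastLessThan_iff lessThan_iff not_le)
  qed
  \<comment> \<open>\<open>A\<close> cannot be much denser than \<open>c\<close> elsewhere, so it
    must keep nearly its share on \<open>{..<4 * t}\<close>.\<close>
  moreover have "real (card (A \<inter> {4 * t..<10 * t})) \<le> (c + \<epsilon>) * (6 * real t) + real m"
  proof -
    have "{y \<in> {4 * t..<10 * t}. y < 1 \<or> y - 1 \<notin> {4 * t..<10 * t}} \<subseteq> {4 * t}" by auto
    from card_mono[OF _ this] have "real m * real (card {y \<in> {4 * t..<10 * t}. y < 1 \<or> y - 1 \<notin> {4 * t..<10 * t}}) \<le> real m"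
      using mult_left_mono[of "real (card {y \<in> {4 * t..<10 * t}. y < 1 \<or> y - 1 \<notin> {4 * t..<10 * t}})" 1 "real m"] by auto
    then show ?thesis using window[OF A(2), of "{4 * t..<10 * t}" 1] by simp
  qed
  ultimately have cL: "real (card L) \<ge> 3 * c * real t"
    using cA et t2 by (simp add: algebra_simps)
  let ?J = "{4 * t..<5 * t}"
  have "card A = card (A \<inter> ?J) + card (A \<inter> ({..<4 * t} \<union> {5 * t..<10 * t}))"
  proof -
    have "A = (A \<inter> ?J) \<union> (A \<inter> ({..<4 * t} \<union> {5 * t..<10 * t}))" using A(1) by auto
    moreover have "(A \<inter> ?J) \<inter> (A \<inter> ({..<4 * t} \<union> {5 * t..<10 * t})) = {}" by auto
    ultimately show ?thesis using finA by (metis card_Un_disjoint finite_Int)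
  qed
  moreover have "real (card (A \<inter> ({..<4 * t} \<union> {5 * t..<10 * t}))) \<le> (c + \<epsilon>) * (9 * real t) + real m * 2"
  proof -
    let ?P = "{..<4 * t} \<union> {5 * t..<10 * t}"
    have "{y \<in> ?P. y < 1 \<or> y - 1 \<notin> ?P} \<subseteq> {0, 5 * t}" by auto
    from card_mono[OF _ this] have "card {y \<in> ?P. y < 1 \<or> y - 1 \<notin> ?P} \<le> 2"
      by (simp add: card_insert_if split: if_splits)
    then have "real m * real (card {y \<in> ?P. y < 1 \<or> y - 1 \<notin> ?P}) \<le> real m * 2"
      by (intro mult_left_mono) auto
    moreover have "card ?P = 9 * t" by (subst card_Un_disjoint) auto
    ultimately show ?thesis using window[OF A(2), of ?P 1] by simp
  qed
  ultimately have cJ: "real (card (A \<inter> ?J)) \<ge> c * real t / 2"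
    using cA et t2 by (simp add: algebra_simps)
  \<comment> \<open>Otherwise all windows of length \<open>B\<close> in \<open>?J\<close> would have
    density below \<open>c / 4\<close>, against at least \<open>c / 2\<close> on \<open>?J\<close>.
    The cube must lie in a window of bounded length so that its generators stay below
    \<open>B\<close>.\<close>
  have "\<exists>s. {s..<s + B} \<subseteq> ?J \<and> real (card (A \<inter> {s..<s + B})) \<ge> c / 4 * real B"
  proof (rule ccontr)
    assume none: "\<not> ?thesis"
    have img: "(\<lambda>i. s + i * 1) ` {..<B} = {s..<s + B}" for s
      using image_add_atLeastLessThan[of s 0 B] by (simp add: lessThan_atLeast0 add.commute)
    have "real (card (A \<inter> ?J)) \<le> c / 4 * real (card ?J) + real B * real (card {y\<in>?J. y < 1 \<or> y - 1 \<notin> ?J})"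
    proof (rule card_le_by_windows)
      fix s assume "(\<lambda>i. s + i * 1) ` {..<B} \<subseteq> ?J"
      then show "real (card (A \<inter> (\<lambda>i. s + i * 1) ` {..<B})) \<le> c / 4 * real B"
        unfolding img using none by (meson less_imp_le not_le)
    qed (use B c in auto)
    moreover have "{y\<in>?J. y < 1 \<or> y - 1 \<notin> ?J} \<subseteq> {4 * t}" by auto
    from card_mono[OF _ this] have "real B * real (card {y\<in>?J. y < 1 \<or> y - 1 \<notin> ?J}) \<le> real B * 1"
      by (intro mult_left_mono) auto
    ultimately have "real (card (A \<inter> ?J)) \<le> c / 4 * real (card ?J) + real B" by linarith
    then show False using cJ t3 B by simp
  qed
  then obtain s where s: "{s..<s + B} \<subseteq> ?J" "real (card (A \<inter> {s..<s + B})) \<ge> c / 4 * real B" by blast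
  obtain a ds where ds: "length ds = k" "cube a ds \<subseteq> A \<inter> {s..<s + B}" "\<And>d. d \<in> set ds \<Longrightarrow> 1 \<le> d \<and> d < B"
    using cube[of "A \<inter> {s..<s + B}" s] s(2) by auto
  let ?N = "reflections L a"
  have pos: "q \<in> A \<and> 4 * t \<le> q \<and> q < 5 * t \<and> x < 4 * t \<and> x \<in> A" if "q \<in> cube a (es)" "x \<in> L" "cube a es \<subseteq> cube a ds" for q x es
    using that ds(2) s(1) by (fastforce simp: L_def)
  \<comment> \<open>Reflections avoid \<open>A\<close>, as \<open>x\<close>, \<open>q\<close> and
    \<open>2 * q - x\<close> would form a progression in \<open>A\<close>.\<close>
  have Nsub: "?N es \<subseteq> {..<10 * t} - A" if sub: "cube a es \<subseteq> cube a ds" for es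
  proof
    fix z assume "z \<in> ?N es"
    then obtain q x where z: "z = 2 * q - x" "q \<in> cube a es" "x \<in> L" by (auto simp: reflections_def)
    note p = pos[OF z(2,3) sub]
    have "z \<notin> A"
    proof
      assume "z \<in> A"
      then have "is_3AP A x (q - x)" using p z(1) by (auto simp: is_3AP_def diff_mult_distrib2)
      then show False using A(2) by (auto simp: ap3_free_def)
    qed
    then show "z \<in> {..<10 * t} - A" using p z(1) by auto
  qed
  have finN: "finite (?N es)" if "cube a es \<subseteq> cube a ds" for es
    using Nsub[OF that] finite_subset by blast
  \<comment> \<open>Reflecting in the base point alone already embeds \<open>L\<close>.\<close>
  have NL: "real (card L) \<le> real (card (?N es))" if sub: "cube a es \<subseteq> cube a ds" for es
  proof -
    have ae: "a \<in> cube a es" by (rule base_in_cube)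
    have "card L = card ((\<lambda>x. 2 * a - x) ` L)"
      by (rule card_image[symmetric], rule inj_onI) (use pos[OF ae _ sub] in fastforce)
    also have "\<dots> \<le> card (?N es)"
      by (rule card_mono[OF finN[OF sub]]) (use ae in \<open>auto simp: reflections_def\<close>)
    finally show ?thesis by simp
  qed
  \<comment> \<open>All reflection sets lie in \<open>{..<10 * t}\<close>, so the average growth
    over \<open>k\<close> generators is below \<open>g\<close>; strictness comes from the nonempty
    initial set.\<close>
  define g where "g = 10 * real t / real k"
  have "real (card (?N ds)) < real (card (?N [])) + real (length ds) * g"
  proof -
    have "card (?N ds) \<le> card {..<10 * t}" using Nsub[of ds] by (intro card_mono) auto
    then have "real (card (?N ds)) \<le> 10 * real t" by simp
    moreover have "real (length ds) * g = 10 * real t" using kpos by (simp add: g_def ds(1))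
    moreover have "cube a [] \<subseteq> cube a ds" by (simp add: base_in_cube)
    then have "real (card (?N [])) > 0" using NL[of "[]"] cL c tpos
      by (smt (verit, best) mult_pos_pos)
    ultimately show ?thesis by linarith
  qed
  from exists_small_increment[OF this] obtain pre d es where
    dec: "ds = pre @ d # es" and inc: "real (card (?N (d # es))) < real (card (?N es)) + g" by blast
  have sub1: "cube a (d # es) \<subseteq> cube a ds" unfolding dec by (rule cube_append_subset)
  have sub2: "cube a es \<subseteq> cube a ds" using sub1 by auto
  have d: "1 \<le> d" "d < B" using ds(3)[of d] dec by auto
  define N where "N = ?N es"
  have Nd: "?N (d # es) = N \<union> (\<lambda>y. y + 2 * d) ` N"
    unfolding N_def by (rule reflections_Cons) (use pos[OF _ _ sub2] in fastforce)
  have fN: "finite N" using finN[OF sub2] by (simp add: N_def)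
  let ?P = "{..<10 * t} - N"
  have AP: "A \<inter> ?P = A" using A(1) Nsub[OF sub2] by (auto simp: N_def)
  \<comment> \<open>A run of step \<open>2 * d\<close> in the complement of \<open>N\<close> starts
    within the first \<open>2 * d\<close> points or right after a point of \<open>N\<close>; in the
    latter case its start belongs to the growth caused by \<open>d\<close>.\<close>
  have starts: "{y\<in>?P. y < 2 * d \<or> y - 2 * d \<notin> ?P} \<subseteq> {..<2 * d} \<union> (?N (d # es) - N)"
  proof
    fix y assume y: "y \<in> {y\<in>?P. y < 2 * d \<or> y - 2 * d \<notin> ?P}"
    show "y \<in> {..<2 * d} \<union> (?N (d # es) - N)"
    proof (cases "y < 2 * d")
      case False
      then have "y - 2 * d \<in> N" using y by auto
      then have "y \<in> (\<lambda>y. y + 2 * d) ` N" using False by (intro image_eqI[of _ _ "y - 2 * d"]) auto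
      then show ?thesis unfolding Nd using y by auto
    qed simp
  qed
  have "card {y\<in>?P. y < 2 * d \<or> y - 2 * d \<notin> ?P} \<le> card ({..<2 * d} \<union> (?N (d # es) - N))"
    by (rule card_mono[OF _ starts]) (use finN[OF sub1] in auto)
  also have "\<dots> \<le> 2 * d + card (?N (d # es) - N)"
    by (rule order.trans[OF card_Un_le]) simp
  also have "card (?N (d # es) - N) = card (?N (d # es)) - card N"
    by (rule card_Diff_subset) (use fN Nd in auto)
  finally have le: "card {y\<in>?P. y < 2 * d \<or> y - 2 * d \<notin> ?P} \<le> 2 * d + (card (?N (d # es)) - card N)" .
  have "card N \<le> card (?N (d # es))" by (rule card_mono[OF finN[OF sub1]]) (use Nd in auto)
  with le have "card {y\<in>?P. y < 2 * d \<or> y - 2 * d \<notin> ?P} + card N \<le> 2 * d + card (?N (d # es))" by linarith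
  moreover have "real (card (?N (d # es))) < real (card N) + g" using inc by (simp add: N_def)
  ultimately have st: "real (card {y\<in>?P. y < 2 * d \<or> y - 2 * d \<notin> ?P}) \<le> 2 * real B + g"
    using d(2) by linarith
  have cP: "real (card ?P) = 10 * real t - real (card N)" "real (card N) \<ge> 3 * c * real t"
  proof -
    have "N \<subseteq> {..<10 * t}" using Nsub[OF sub2] by (auto simp: N_def)
    then show "real (card ?P) = 10 * real t - real (card N)"
      using card_mono[of "{..<10*t}" N] by (simp add: card_Diff_subset fN of_nat_diff)
    show "real (card N) \<ge> 3 * c * real t" using NL[OF sub2] cL by (simp add: N_def)
  qed
  have "real (card A) \<le> (c + \<epsilon>) * real (card ?P) + real m * real (card {y\<in>?P. y < 2 * d \<or> y - 2 * d \<notin> ?P})"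
    using window[OF A(2), of ?P "2 * d"] d AP by simp
  also have "\<dots> \<le> (c + \<epsilon>) * (10 * real t - 3 * c * real t) + real m * (2 * real B + g)"
    by (intro add_mono mult_left_mono) (use cP st c \<open>\<epsilon> > 0\<close> in auto)
  also have "\<dots> \<le> 10 * c * real t + 10 * \<epsilon> * real t - 3 * c\<^sup>2 * real t + 2 * real m * real B + real m * g"
    using \<open>\<epsilon> > 0\<close> c tpos by (simp add: algebra_simps power2_eq_square)
  also have "real m * g \<le> c\<^sup>2 * real t / 2"
  proof -
    have "20 * real m \<le> c\<^sup>2 * real k" using k c by (simp add: field_simps)
    then have "20 * real m * real t \<le> c\<^sup>2 * real k * real t" by (intro mult_right_mono) auto
    then show ?thesis using kpos by (simp add: g_def field_simps)
  qed
  also have "10 * \<epsilon> * real t = c\<^sup>2 * real t / 2" by (simp add: \<epsilon>_def)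
  finally have "real (card A) \<le> 10 * c * real t + c\<^sup>2 * real t / 2 - 3 * c\<^sup>2 * real t
      + 2 * real m * real B + c\<^sup>2 * real t / 2" by simp
  moreover have "c\<^sup>2 * real t > 0" using c tpos by simp
  ultimately have "real (card A) < 10 * c * real t" using t1 by linarith
  then show False using cA by simp
qed

text \<open>If the density stayed above \<open>\<delta>\<close>, the infimum of
  \<open>roth_number n / n\<close> would be positive and would satisfy both hypotheses of
  \<open>no_positive_roth_density\<close>.\<close>

theorem roth_density:
  fixes \<delta> :: real
  assumes "\<delta> > 0"
  shows "\<exists>m\<ge>1. real (roth_number m) < \<delta> * real m"
proof (rule ccontr)
  assume "\<not> ?thesis"
  then have ge: "\<delta> * real m \<le> real (roth_number m)" if "m \<ge> 1" for m using that by (meson not_le)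
  let ?f = "\<lambda>n. real (roth_number n) / real n"
  define c where "c = (INF n\<in>{1..}. ?f n)"
  have bdd: "bdd_below (?f ` {1..})" by (rule bdd_belowI[of _ 0]) auto
  have "\<delta> \<le> c" unfolding c_def
    by (rule cINF_greatest) (use ge in \<open>auto simp: field_simps\<close>)
  show False
  proof (rule no_positive_roth_density[of c])
    show "c > 0" using \<open>\<delta> \<le> c\<close> assms by simp
    show "c * real n \<le> real (roth_number n)" if "n \<ge> 1" for n
    proof -
      have "c \<le> ?f n" unfolding c_def by (rule cINF_lower[OF bdd]) (use that in auto)
      then show ?thesis using that by (simp add: field_simps)
    qed
    show "\<exists>m\<ge>1. real (roth_number m) \<le> (c + \<epsilon>) * real m" if "\<epsilon> > 0" for \<epsilon>
    proof -
      have "c < c + \<epsilon>" using that by simp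
      then obtain m where "m \<in> {1..}" "?f m < c + \<epsilon>"
        unfolding c_def using cINF_less_iff[OF _ bdd, of "(INF n\<in>{1..}. ?f n) + \<epsilon>"] by auto
      then show ?thesis by (intro exI[of _ m]) (auto simp: field_simps)
    qed
  qed
qed

text \<open>For a fixed step \<open>D\<close>, delete from \<open>W\<close> the first term of each
  progression with difference \<open>j * D\<close>, \<open>j \<le> m\<close>. Up to a boundary term
  the rest has density at most \<open>\<epsilon> / 2\<close>, by Roth's theorem on windows of step
  \<open>D\<close>, so at least \<open>\<epsilon> * n / 4\<close> first terms were deleted. Summing
  over linearly many \<open>D\<close> counts each progression at most \<open>m\<close>
  times.\<close>

lemma varnavides:
  fixes \<epsilon> :: real
  assumes "\<epsilon> > 0"
  shows "\<exists>\<delta>>0. \<exists>n0. \<forall>n\<ge>n0. \<forall>W\<subseteq>{1..n}. real (card W) \<ge> \<epsilon> * real n \<longrightarrow>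
    real (card {(a, d). is_3AP W a d}) \<ge> \<delta> * (real n)\<^sup>2"
proof -
  obtain m where m: "m \<ge> 1" "real (roth_number m) < \<epsilon> / 2 * real m"
    using roth_density[of "\<epsilon> / 2"] assms by auto
  define \<delta> where "\<delta> = \<epsilon>\<^sup>2 / (32 * (real m)\<^sup>2)"
  define n0 where "n0 = nat \<lceil>8 * real m / \<epsilon>\<rceil>"
  have "\<delta> > 0" using assms m by (simp add: \<delta>_def)
  moreover have "real (card {(a, d). is_3AP W a d}) \<ge> \<delta> * (real n)\<^sup>2"
    if n: "n \<ge> n0" and W: "W \<subseteq> {1..n}" "real (card W) \<ge> \<epsilon> * real n" for n W
  proof -
    have finW: "finite W" using W(1) finite_subset by blast
    let ?AP = "{(a, d). is_3AP W a d}"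
    have finAP: "finite ?AP"
      by (rule finite_subset[of _ "{1..n} \<times> {1..n}"]) (use W(1) in \<open>fastforce simp: is_3AP_def\<close>, simp)
    let ?E = "\<lambda>D. {(a, d). is_3AP W a d \<and> (\<exists>j\<in>{1..m}. d = j * D)}"
    have finE: "finite (?E D)" for D by (rule finite_subset[OF _ finAP]) auto
    \<comment> \<open>The largest range of steps whose boundary term \<open>m * D\<close> stays
      within \<open>\<epsilon> * n / 4\<close>; \<open>n0\<close> makes the quotient at least 2, so
      rounding down costs at most half.\<close>
    define D0 where "D0 = nat \<lfloor>\<epsilon> * real n / (4 * real m)\<rfloor>"
    have D0: "real D0 \<le> \<epsilon> * real n / (4 * real m)" using assms unfolding D0_def by simp
    have "8 * real m / \<epsilon> \<le> real n" using n unfolding n0_def by linarith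
    then have "2 \<le> \<epsilon> * real n / (4 * real m)" using assms m by (simp add: field_simps)
    then have D0': "real D0 \<ge> \<epsilon> * real n / (8 * real m)"
      unfolding D0_def by (simp add: field_simps) linarith
    have many: "real (card (?E D)) \<ge> \<epsilon> * real n / 4" if D: "D \<in> {1..D0}" for D
    proof -
      let ?W = "W - fst ` ?E D"
      have "real (card (?W \<inter> {1..n})) \<le> \<epsilon> / 2 * real (card {1..n}) + real m * real (card {y\<in>{1..n}. y < D \<or> y - D \<notin> {1..n}})"
      proof (rule card_le_by_windows)
        fix a
        let ?f = "\<lambda>i. a + i * D"
        let ?X = "{i\<in>{..<m}. ?f i \<in> ?W}"
        have "ap3_free ?X"
          unfolding ap3_free_def
        proof (intro allI notI)
          fix i j assume ij: "is_3AP ?X i j"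
          then have "is_3AP ?W (?f i) (j * D)" "j \<in> {1..m}"
            using D by (auto simp: is_3AP_def algebra_simps)
          then have "(?f i, j * D) \<in> ?E D" by (auto simp: is_3AP_def)
          then have "?f i \<in> fst ` ?E D" by force
          then show False using ij by (auto simp: is_3AP_def)
        qed
        then have "card ?X \<le> roth_number m" by (intro card_le_roth_number) auto
        moreover have eq: "?W \<inter> ?f ` {..<m} = ?f ` ?X" by auto
        moreover have "card (?f ` ?X) \<le> card ?X" by (rule card_image_le) auto
        ultimately show "real (card (?W \<inter> ?f ` {..<m})) \<le> \<epsilon> / 2 * real m"
          unfolding eq using m(2) by linarith
      qed (use D m assms in auto)
      moreover have "card {y\<in>{1..n}. y < D \<or> y - D \<notin> {1..n}} \<le> card {1..D}"
        by (rule card_mono) auto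
      then have "real m * real (card {y\<in>{1..n}. y < D \<or> y - D \<notin> {1..n}}) \<le> real m * real D0"
        using D by (intro mult_left_mono) auto
      moreover have "real m * real D0 \<le> \<epsilon> * real n / 4"
        using D0 m(1) by (simp add: field_simps)
      ultimately have "real (card (?W \<inter> {1..n})) \<le> \<epsilon> / 2 * real (card {1..n}) + \<epsilon> * real n / 4"
        by linarith
      then have "real (card (?W \<inter> {1..n})) \<le> \<epsilon> * real n / 2 + \<epsilon> * real n / 4" by simp
      moreover have "?W \<inter> {1..n} = ?W" using W(1) by blast
      moreover have "card W \<le> card (?W \<union> fst ` ?E D)"
        by (rule card_mono) (use finW finE in auto)
      then have "card W \<le> card ?W + card (fst ` ?E D)"
        by (rule order.trans[OF _ card_Un_le])
      moreover have "card (fst ` ?E D) \<le> card (?E D)" by (rule card_image_le[OF finE])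
      ultimately show ?thesis using W(2) by simp
    qed
    have "real D0 * (\<epsilon> * real n / 4) = (\<Sum>D\<in>{1..D0}. \<epsilon> * real n / 4)" by simp
    also have "\<dots> \<le> (\<Sum>D\<in>{1..D0}. real (card (?E D)))" by (rule sum_mono) (use many in auto)
    also have "\<dots> = real (card (SIGMA D:{1..D0}. ?E D))"
      using finE by (subst card_SigmaI) auto
    also have "\<dots> \<le> real (card ({1..m} \<times> ?AP))"
    proof -
      have "card (SIGMA D:{1..D0}. ?E D) \<le> card ({1..m} \<times> ?AP)"
      proof (rule card_inj_on_le)
        \<comment> \<open>The quotient \<open>d div D\<close> is the multiplier \<open>j\<close>;
          together with \<open>d\<close> it determines \<open>D\<close>.\<close>
        let ?h = "\<lambda>(D, a, d). (d div D, (a, d :: nat))"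
        show "inj_on ?h (SIGMA D:{1..D0}. ?E D)"
        proof (rule inj_onI)
          fix p q assume pq: "p \<in> (SIGMA D:{1..D0}. ?E D)" "q \<in> (SIGMA D:{1..D0}. ?E D)" "?h p = ?h q"
          then obtain D a j D' a' j' where p: "p = (D, a, j * D)" "1 \<le> D" "1 \<le> j"
            and q: "q = (D', a', j' * D')" "1 \<le> D'" by auto
          have "a = a'" "j = j'" "j * D = j' * D'" using pq(3) p q by auto
          then show "p = q" using p q by simp
        qed
        show "?h ` (SIGMA D:{1..D0}. ?E D) \<subseteq> {1..m} \<times> ?AP" by auto
        show "finite ({1..m} \<times> ?AP)" using finAP by simp
      qed
      then show ?thesis by simp
    qed
    also have "\<dots> = real m * real (card ?AP)" by (simp add: card_cartesian_product)
    finally have 1: "real D0 * (\<epsilon> * real n / 4) \<le> real m * real (card ?AP)" .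
    have "\<epsilon> * real n / (8 * real m) * (\<epsilon> * real n / 4) \<le> real D0 * (\<epsilon> * real n / 4)"
      by (rule mult_right_mono[OF D0']) (use assms in auto)
    with 1 have "\<epsilon> * real n / (8 * real m) * (\<epsilon> * real n / 4) \<le> real m * real (card ?AP)" by linarith
    then show ?thesis using m(1) by (simp add: \<delta>_def field_simps power2_eq_square)
  qed
  ultimately show ?thesis by blast
qed

section \<open>Counting lemmas\<close>

text \<open>Disjoint blocks are filled independently, and each excludes one of at most
  \<open>K\<close> patterns, a factor \<open>1 - 1 / K\<close>. This serves both as a probability
  estimate for random partitions and as a saving for choices from lists.\<close>

lemma card_PiE_avoiding_blocks:
  fixes K :: real
  assumes "finite I" "finite V" "\<And>x. x \<in> V \<Longrightarrow> finite (P x)"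
    and "\<And>i. i \<in> I \<Longrightarrow> b i \<subseteq> V"
    and "\<And>i j. i \<in> I \<Longrightarrow> j \<in> I \<Longrightarrow> i \<noteq> j \<Longrightarrow> b i \<inter> b j = {}"
    and "\<And>i. i \<in> I \<Longrightarrow> \<psi> i \<in> PiE (b i) P"
    and "\<And>i. i \<in> I \<Longrightarrow> real (\<Prod>x\<in>b i. card (P x)) \<le> K"
    and "K \<ge> 1"
  shows "real (card {\<phi> \<in> PiE V P. \<forall>i\<in>I. restrict \<phi> (b i) \<noteq> \<psi> i})
    \<le> (1 - 1 / K) ^ card I * real (\<Prod>x\<in>V. card (P x))"
  using assms(1-7)
proof (induction I arbitrary: V rule: finite_induct)
  case empty
  then show ?case by (simp add: card_PiE)
next
  case (insert i I)
  let ?V = "V - b i"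
  let ?B = "PiE (b i) P - {\<psi> i}"
  let ?C = "{\<phi> \<in> PiE ?V P. \<forall>j\<in>I. restrict \<phi> (b j) \<noteq> \<psi> j}"
  let ?S = "{\<phi> \<in> PiE V P. \<forall>j\<in>insert i I. restrict \<phi> (b j) \<noteq> \<psi> j}"
  have bi: "b i \<subseteq> V" "finite (b i)" using insert.prems(3)[of i] insert.prems(1) finite_subset by auto
  have bj: "b j \<subseteq> ?V" if "j \<in> I" for j
    using insert.prems(3)[of j] insert.prems(4)[of i j] that insert.hyps(2) by auto
  have fB: "finite (PiE (b i) P)" using bi insert.prems(2) by (intro finite_PiE) auto
  have fC: "finite ?C" using insert.prems(1,2) by (intro finite_subset[OF _ finite_PiE[of ?V P]]) auto
  have IH: "real (card ?C) \<le> (1 - 1 / K) ^ card I * real (\<Prod>x\<in>?V. card (P x))"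
    using bj insert.prems by (intro insert.IH) auto
  have "card ?S \<le> card (?B \<times> ?C)"
  proof (rule card_inj_on_le)
    let ?h = "\<lambda>\<phi>. (restrict \<phi> (b i), restrict \<phi> ?V)"
    show "inj_on ?h ?S"
    proof (rule inj_onI)
      fix \<phi> \<phi>' assume \<phi>: "\<phi> \<in> ?S" "\<phi>' \<in> ?S" "?h \<phi> = ?h \<phi>'"
      have eq: "\<phi> x = \<phi>' x" if "x \<in> V" for x
        using \<phi>(3) that by (metis (no_types, lifting) Diff_iff Pair_inject restrict_apply')
      show "\<phi> = \<phi>'"
        by (rule PiE_ext[of _ V P]) (use \<phi>(1,2) eq in auto)
    qed
    show "?h ` ?S \<subseteq> ?B \<times> ?C"
    proof
      fix y assume "y \<in> ?h ` ?S"
      then obtain \<phi> where \<phi>: "\<phi> \<in> ?S" "y = ?h \<phi>" by blast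
      have "restrict \<phi> ?V \<in> PiE ?V P" "restrict \<phi> (b i) \<in> PiE (b i) P" using \<phi>(1) bi(1) by auto
      moreover have "restrict (restrict \<phi> ?V) (b j) = restrict \<phi> (b j)" if "j \<in> I" for j
        using bj[OF that] by (simp add: inf.absorb2)
      ultimately show "y \<in> ?B \<times> ?C" using \<phi> by auto
    qed
    show "finite (?B \<times> ?C)" using fB fC by auto
  qed
  also have "\<dots> = (card (PiE (b i) P) - 1) * card ?C"
    using insert.prems(5)[of i] fB by (simp add: card_cartesian_product)
  finally have "real (card ?S) \<le> real ((card (PiE (b i) P) - 1) * card ?C)"
    by (rule of_nat_mono)
  also have "\<dots> = real (card (PiE (b i) P) - 1) * real (card ?C)" by (rule of_nat_mult)
  also have "\<dots> \<le> ((1 - 1 / K) * real (\<Prod>x\<in>b i. card (P x))) * ((1 - 1 / K) ^ card I * real (\<Prod>x\<in>?V. card (P x)))"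
  proof (rule mult_mono[OF _ IH])
    have "card (PiE (b i) P) \<noteq> 0" using insert.prems(5)[of i] fB by auto
    then have "card (PiE (b i) P) \<ge> 1" by linarith
    then have "real (card (PiE (b i) P) - 1) = real (\<Prod>x\<in>b i. card (P x)) - 1"
      using bi(2) by (simp add: card_PiE of_nat_diff)
    also have "\<dots> \<le> (1 - 1 / K) * real (\<Prod>x\<in>b i. card (P x))"
      using insert.prems(6)[of i] \<open>K \<ge> 1\<close> by (simp add: field_simps)
    finally show "real (card (PiE (b i) P) - 1) \<le> (1 - 1 / K) * real (\<Prod>x\<in>b i. card (P x))" .
  qed (use \<open>K \<ge> 1\<close> in \<open>auto intro!: mult_nonneg_nonneg prod_nonneg\<close>)
  also have "\<dots> = (1 - 1 / K) ^ card (insert i I) * real ((\<Prod>x\<in>b i. card (P x)) * (\<Prod>x\<in>?V. card (P x)))"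
    using insert.hyps by simp
  also have "(\<Prod>x\<in>b i. card (P x)) * (\<Prod>x\<in>?V. card (P x)) = (\<Prod>x\<in>V. card (P x))"
    using prod.subset_diff[OF bi(1) insert.prems(1), of "\<lambda>x. card (P x)"] by (simp add: mult.commute)
  finally show ?case .
qed

text \<open>The value 0 encodes ``uncoloured''.\<close>

definition sparse_colorings :: "nat \<Rightarrow> nat \<Rightarrow> nat \<Rightarrow> (nat \<Rightarrow> nat) set" where
  "sparse_colorings r n k = {p \<in> {1..n} \<rightarrow>\<^sub>E {0..r}. card {x \<in> {1..n}. p x \<noteq> 0} \<le> k}"

lemma finite_sparse_colorings: "finite (sparse_colorings r n k)"
  unfolding sparse_colorings_def by (rule finite_subset[OF _ finite_PiE[of "{1..n}" "\<lambda>_. {0..r}"]]) auto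

text \<open>Weight each coloured point by \<open>u\<close>: a sparse colouring weighs at least
  \<open>u ^ k\<close>, while the total weight of all functions factorises over the points.\<close>

lemma card_sparse_colorings_weighted:
  fixes u :: real
  assumes "0 < u" "u \<le> 1"
  shows "u ^ k * real (card (sparse_colorings r n k)) \<le> (1 + real r * u) ^ n"
proof -
  let ?w = "\<lambda>v::nat. if v = 0 then 1 else u"
  have w: "u ^ k \<le> (\<Prod>x\<in>{1..n}. ?w (p x))" if "p \<in> sparse_colorings r n k" for p
  proof -
    have "(\<Prod>x\<in>{1..n}. ?w (p x)) = (\<Prod>x\<in>{x\<in>{1..n}. p x \<noteq> 0}. u)"
      by (subst prod.inter_filter) (auto intro!: prod.cong)
    also have "\<dots> = u ^ card {x\<in>{1..n}. p x \<noteq> 0}" by simp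
    also have "\<dots> \<ge> u ^ k" using that assms by (intro power_decreasing) (auto simp: sparse_colorings_def)
    finally show ?thesis .
  qed
  have "u ^ k * real (card (sparse_colorings r n k)) = (\<Sum>p\<in>sparse_colorings r n k. u ^ k)" by simp
  also have "\<dots> \<le> (\<Sum>p\<in>sparse_colorings r n k. \<Prod>x\<in>{1..n}. ?w (p x))"
    by (rule sum_mono) (use w in auto)
  also have "\<dots> \<le> (\<Sum>p\<in>{1..n} \<rightarrow>\<^sub>E {0..r}. \<Prod>x\<in>{1..n}. ?w (p x))"
    by (rule sum_mono2) (use assms in \<open>auto simp: sparse_colorings_def intro!: finite_PiE prod_nonneg\<close>)
  also have "\<dots> = (\<Prod>x\<in>{1..n}. \<Sum>v\<in>{0..r}. ?w v)"
    by (rule prod_sum_PiE[symmetric]) auto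
  also have "(\<Sum>v\<in>{0..r}. ?w v) = 1 + real r * u"
    by (simp add: sum.atLeast_Suc_atMost[of 0 r])
  finally show ?thesis by simp
qed

lemma card_sparse_colorings_le:
  fixes \<theta> :: real
  assumes "\<theta> > 0"
  shows "\<exists>\<epsilon>>0. \<forall>n k. real k \<le> \<epsilon> * real n \<longrightarrow> real (card (sparse_colorings r n k)) \<le> 2 powr (\<theta> * real n)"
proof -
  \<comment> \<open>\<open>u\<close> makes \<open>(1 + r * u) ^ n\<close> use at most half of the
    exponent \<open>\<theta> * n\<close>; below, \<open>\<epsilon>\<close> is chosen to leave the
    other half to \<open>(1 / u) ^ k\<close>.\<close>
  define u where "u = min (1/2) (\<theta> * ln 2 / (2 * (real r + 1)))"
  have u: "0 < u" "u < 1" using assms by (auto simp: u_def)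
  have ru: "real r * u \<le> \<theta> / 2 * ln 2"
  proof -
    have "real r * u \<le> (real r + 1) * (\<theta> * ln 2 / (2 * (real r + 1)))"
      by (rule mult_mono) (use assms u in \<open>auto simp: u_def\<close>)
    also have "\<dots> = \<theta> / 2 * ln 2" by (simp add: field_simps)
    finally show ?thesis .
  qed
  define \<epsilon> where "\<epsilon> = \<theta> / 2 * ln 2 / ln (1 / u)"
  have lnu: "ln (1 / u) > 0" using u by simp
  have "\<epsilon> > 0" using lnu assms by (simp add: \<epsilon>_def)
  moreover have "real (card (sparse_colorings r n k)) \<le> 2 powr (\<theta> * real n)" if k: "real k \<le> \<epsilon> * real n" for n k
  proof -
    have "1 + real r * u \<le> exp (real r * u)" by (rule exp_ge_add_one_self)
    then have "(1 + real r * u) ^ n \<le> exp (real r * u) ^ n" using u by (intro power_mono) auto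
    also have "\<dots> = exp (real n * (real r * u))" by (simp add: exp_of_nat_mult)
    also have "\<dots> \<le> exp (real n * (\<theta> / 2 * ln 2))" using mult_left_mono[OF ru, of "real n"] by simp
    finally have 1: "u ^ k * real (card (sparse_colorings r n k)) \<le> exp (real n * (\<theta> / 2 * ln 2))"
      using card_sparse_colorings_weighted[of u k r n] u by linarith
    have "(1 / u) ^ k = exp (real k * ln (1 / u))" using u by (simp add: exp_of_nat_mult)
    also have "\<dots> \<le> exp (\<epsilon> * real n * ln (1 / u))" using k lnu by simp
    also have "\<epsilon> * real n * ln (1 / u) = real n * (\<theta> / 2 * ln 2)" using lnu by (simp add: \<epsilon>_def)
    finally have 2: "(1 / u) ^ k \<le> exp (real n * (\<theta> / 2 * ln 2))" .
    have "real (card (sparse_colorings r n k)) = (1 / u) ^ k * (u ^ k * real (card (sparse_colorings r n k)))"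
      using u by (simp add: power_one_over)
    also have "\<dots> \<le> exp (real n * (\<theta> / 2 * ln 2)) * exp (real n * (\<theta> / 2 * ln 2))"
      by (rule mult_mono[OF 2 1]) (use u in auto)
    also have "\<dots> = exp (\<theta> * real n * ln 2)" by (simp add: exp_add[symmetric] algebra_simps)
    also have "\<dots> = 2 powr (\<theta> * real n)" by (simp add: powr_def)
    finally show ?thesis .
  qed
  ultimately show ?thesis by blast
qed

lemma eventually_linear_times_power_less:
  fixes C \<rho> :: real
  assumes "0 \<le> \<rho>" "\<rho> < 1"
  shows "\<exists>n0. \<forall>n\<ge>n0. real n * C * \<rho> ^ n < 1"
proof -
  have "(\<lambda>n. C * (real n * \<rho> ^ n)) \<longlonglongrightarrow> C * 0"
    using assms by (intro tendsto_intros powser_times_n_limit_0) simp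
  then have "\<forall>\<^sub>F n in sequentially. C * (real n * \<rho> ^ n) < 1"
    by (rule order_tendstoD(2)) simp
  then show ?thesis by (simp add: eventually_sequentially mult.assoc mult.left_commute)
qed

text \<open>Partition \<open>{1..n}\<close> at random into \<open>M\<close> classes. For fixed
  \<open>x\<close> the pairs \<open>{a, 2 * x - a}\<close> are disjoint, so if \<open>D x\<close> is
  large, a given class contains none of them with probability at most \<open>\<rho> ^ n\<close>. A
  union bound over \<open>x\<close> and the classes leaves a partition in which every class works;
  its smallest class has at most \<open>n / M\<close> points.\<close>

lemma exists_sparse_set_hitting_pairs:
  fixes \<eta> :: real
  assumes "\<eta> > 0" "M \<ge> 2"
  shows "\<exists>n0. \<forall>n\<ge>n0. \<forall>D. (\<forall>x. D x \<subseteq> {a\<in>{1..n}. a < x \<and> 2 * x - a \<in> {1..n}}) \<longrightarrow>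
    (\<exists>S\<subseteq>{1..n}. real (card S) \<le> real n / real M \<and>
      (\<forall>x\<in>{1..n}. real (card (D x)) \<ge> \<eta> * real n \<longrightarrow> (\<exists>a\<in>D x. a \<in> S \<and> 2 * x - a \<in> S)))"
proof -
  define q :: real where "q = 1 - 1 / (real M)\<^sup>2"
  have q: "0 < q" "q < 1" using \<open>M \<ge> 2\<close> by (auto simp: q_def field_simps power2_eq_square intro!: less_1_mult)
  define \<rho> where "\<rho> = q powr \<eta>"
  have \<rho>: "0 \<le> \<rho>" "\<rho> < 1" using q assms(1) powr_less_mono2[of \<eta> q 1] by (auto simp: \<rho>_def)
  obtain n0 where n0: "\<And>n. n \<ge> n0 \<Longrightarrow> real n * real M * \<rho> ^ n < 1"
    using eventually_linear_times_power_less[OF \<rho>] by blast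
  have main: "\<exists>S\<subseteq>{1..n}. real (card S) \<le> real n / real M \<and>
      (\<forall>x\<in>{1..n}. real (card (D x)) \<ge> \<eta> * real n \<longrightarrow> (\<exists>a\<in>D x. a \<in> S \<and> 2 * x - a \<in> S))"
    if n: "n \<ge> n0" and D: "\<And>x. D x \<subseteq> {a\<in>{1..n}. a < x \<and> 2 * x - a \<in> {1..n}}" for n D
  proof -
    let ?F = "{1..n} \<rightarrow>\<^sub>E {..<M}"
    let ?X = "{x\<in>{1..n}. real (card (D x)) \<ge> \<eta> * real n}"
    let ?Bad = "\<lambda>x i. {\<phi>\<in>?F. \<forall>a\<in>D x. \<not> (\<phi> a = i \<and> \<phi> (2 * x - a) = i)}"
    have finF: "finite ?F" by (intro finite_PiE) auto
    have cF: "card ?F = M ^ n" by (simp add: card_PiE)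
    have bad: "real (card (?Bad x i)) \<le> \<rho> ^ n * real M ^ n" if x: "x \<in> ?X" and i: "i < M" for x i
    proof -
      have finD: "finite (D x)" by (rule finite_subset[OF D]) auto
      let ?b = "\<lambda>a. {a, 2 * x - a}"
      let ?\<psi> = "\<lambda>a. restrict (\<lambda>_. i) (?b a)"
      have sub: "?Bad x i \<subseteq> {\<phi>\<in>?F. \<forall>a\<in>D x. restrict \<phi> (?b a) \<noteq> ?\<psi> a}"
      proof
        fix \<phi> assume "\<phi> \<in> ?Bad x i"
        moreover have "\<phi> a = i \<and> \<phi> (2 * x - a) = i" if "restrict \<phi> (?b a) = ?\<psi> a" for a
          using fun_cong[OF that, of a] fun_cong[OF that, of "2 * x - a"] by simp
        ultimately show "\<phi> \<in> {\<phi>\<in>?F. \<forall>a\<in>D x. restrict \<phi> (?b a) \<noteq> ?\<psi> a}" by blast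
      qed
      have "real (card (?Bad x i)) \<le> real (card {\<phi>\<in>?F. \<forall>a\<in>D x. restrict \<phi> (?b a) \<noteq> ?\<psi> a})"
        using card_mono[OF _ sub] finF by simp
      also have "\<dots> \<le> (1 - 1 / (real M)\<^sup>2) ^ card (D x) * real (\<Prod>x\<in>{1..n}. card {..<M})"
      proof (rule card_PiE_avoiding_blocks)
        show "?b a \<inter> ?b a' = {}" if "a \<in> D x" "a' \<in> D x" "a \<noteq> a'" for a a'
        proof -
          have "a < x" "a' < x" using that D[of x] by auto
          then show ?thesis using that(3) by auto
        qed
        show "?b a \<subseteq> {1..n}" if "a \<in> D x" for a using that D[of x] by auto
        show "?\<psi> a \<in> PiE (?b a) (\<lambda>_. {..<M})" for a using i by auto
        show "real (\<Prod>x\<in>?b a. card {..<M}) \<le> (real M)\<^sup>2" if "a \<in> D x" for a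
        proof -
          have "card (?b a) = 2" using that D[of x] by (auto simp: card_insert_if)
          then show ?thesis by (simp add: power2_eq_square)
        qed
        show "1 \<le> (real M)\<^sup>2" using \<open>M \<ge> 2\<close> by simp
      qed (use finD in auto)
      also have "\<dots> = q ^ card (D x) * real M ^ n" by (simp add: q_def)
      also have "q ^ card (D x) = q powr real (card (D x))" using q by (simp add: powr_realpow)
      also have "\<dots> \<le> q powr (\<eta> * real n)" using x q by (intro powr_mono') auto
      also have "\<dots> = \<rho> powr real n" by (simp add: \<rho>_def powr_powr)
      also have "\<dots> = \<rho> ^ n" using q by (simp add: \<rho>_def powr_realpow)
      finally show ?thesis by (simp add: mult_right_mono)
    qed
    have "card (\<Union>x\<in>?X. \<Union>i\<in>{..<M}. ?Bad x i) \<le> (\<Sum>x\<in>?X. card (\<Union>i\<in>{..<M}. ?Bad x i))"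
      by (rule card_UN_le) simp
    also have "\<dots> \<le> (\<Sum>x\<in>?X. \<Sum>i\<in>{..<M}. card (?Bad x i))"
      by (intro sum_mono card_UN_le) simp
    finally have "real (card (\<Union>x\<in>?X. \<Union>i\<in>{..<M}. ?Bad x i)) \<le> real (\<Sum>x\<in>?X. \<Sum>i\<in>{..<M}. card (?Bad x i))"
      by (rule of_nat_mono)
    also have "\<dots> = (\<Sum>x\<in>?X. \<Sum>i\<in>{..<M}. real (card (?Bad x i)))" by simp
    also have "\<dots> \<le> (\<Sum>x\<in>?X. \<Sum>i\<in>{..<M}. \<rho> ^ n * real M ^ n)"
      by (intro sum_mono bad) auto
    also have "\<dots> = real (card ?X) * real M * (\<rho> ^ n * real M ^ n)" by simp
    also have "\<dots> \<le> real n * real M * (\<rho> ^ n * real M ^ n)"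
    proof -
      have "card ?X \<le> card {1..n}" by (rule card_mono) auto
      then show ?thesis using \<rho> by (intro mult_right_mono) auto
    qed
    also have "\<dots> = (real n * real M * \<rho> ^ n) * real M ^ n" by simp
    also have "\<dots> < 1 * real M ^ n" using n0[OF n] \<open>M \<ge> 2\<close> by (intro mult_strict_right_mono) auto
    also have "\<dots> = real (card ?F)" by (simp only: cF of_nat_power mult_1)
    finally have lt: "real (card (\<Union>x\<in>?X. \<Union>i\<in>{..<M}. ?Bad x i)) < real (card ?F)" .
    have "\<not> ?F \<subseteq> (\<Union>x\<in>?X. \<Union>i\<in>{..<M}. ?Bad x i)"
    proof
      assume sub: "?F \<subseteq> (\<Union>x\<in>?X. \<Union>i\<in>{..<M}. ?Bad x i)"
      have "finite (\<Union>x\<in>?X. \<Union>i\<in>{..<M}. ?Bad x i)"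
        by (rule finite_subset[OF _ finF]) blast
      from card_mono[OF this sub] lt show False by linarith
    qed
    then obtain \<phi> where \<phi>: "\<phi> \<in> ?F" "\<phi> \<notin> (\<Union>x\<in>?X. \<Union>i\<in>{..<M}. ?Bad x i)" by blast
    let ?S = "\<lambda>i. {x\<in>{1..n}. \<phi> x = i}"
    have "\<exists>i<M. real (card (?S i)) \<le> real n / real M"
    proof (rule ccontr)
      assume "\<not> ?thesis"
      then have gt: "real (card (?S i)) > real n / real M" if "i < M" for i using that by (meson not_le)
      have "(\<Sum>i\<in>{..<M}. real n / real M) < (\<Sum>i\<in>{..<M}. real (card (?S i)))"
        by (rule sum_strict_mono) (use gt \<open>M \<ge> 2\<close> in \<open>auto simp: lessThan_empty_iff\<close>)
      also have "\<dots> = real (card (\<Union>i\<in>{..<M}. ?S i))"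
        by (subst card_UN_disjoint) auto
      also have "\<dots> \<le> real (card {1..n})" by (intro of_nat_mono card_mono) auto
      finally show False using \<open>M \<ge> 2\<close> by simp
    qed
    then obtain i where i: "i < M" "real (card (?S i)) \<le> real n / real M" by blast
    have "\<exists>a\<in>D x. a \<in> ?S i \<and> 2 * x - a \<in> ?S i"
      if x: "x \<in> {1..n}" "real (card (D x)) \<ge> \<eta> * real n" for x
    proof -
      have "\<phi> \<notin> ?Bad x i"
      proof
        assume "\<phi> \<in> ?Bad x i"
        moreover have "x \<in> ?X" "i \<in> {..<M}" using x i(1) by auto
        ultimately have "\<phi> \<in> (\<Union>x\<in>?X. \<Union>i\<in>{..<M}. ?Bad x i)" by (intro UN_I)
        then show False using \<phi>(2) by contradiction
      qed
      then obtain a where "a \<in> D x" "\<phi> a = i" "\<phi> (2 * x - a) = i" using \<phi>(1) by blast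
      then show ?thesis using D[of x] by blast
    qed
    then show ?thesis using i(2) by (intro exI[of _ "?S i"]) auto
  qed
  show ?thesis by (intro exI[of _ n0] allI impI main) auto
qed

section \<open>Rainbow-free colourings and lists of two colours\<close>

text \<open>The midpoint is required to lie in \<open>Y\<close> because \<open>Y\<close> will
  consist of points about which few symmetric pairs are bichromatic; hence linked points mostly
  agree in colour.\<close>

definition linked :: "nat set \<Rightarrow> nat \<Rightarrow> nat \<Rightarrow> bool" where
  "linked Y x z \<longleftrightarrow> x \<in> Y \<and> z \<in> Y \<and> x \<noteq> z \<and> (\<exists>y\<in>Y. x + z = 2 * y)"

text \<open>Sum the hypothesis over the midpoints; the factor 2 comes from the two orders of a
  pair.\<close>

lemma card_linked_bichromatic_le:
  fixes \<eta> :: real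
  assumes Y: "Y \<subseteq> {1..n}" and "\<eta> \<ge> 0"
    and bad: "\<And>y. y \<in> Y \<Longrightarrow> real (card {a\<in>Y. a < y \<and> 2 * y - a \<in> Y \<and> c a \<noteq> c (2 * y - a)}) \<le> \<eta> * real n"
  shows "real (card {(x, z). linked Y x z \<and> c x \<noteq> c z}) \<le> 2 * \<eta> * (real n)\<^sup>2"
proof -
  let ?D = "\<lambda>y. {a\<in>Y. a < y \<and> 2 * y - a \<in> Y \<and> c a \<noteq> c (2 * y - a)}"
  let ?S = "SIGMA y:Y. ?D y"
  let ?f = "\<lambda>(y, a). (a, 2 * y - a)"
  have finY: "finite Y" using Y finite_subset by blast
  have "{(x, z). linked Y x z \<and> c x \<noteq> c z} \<subseteq> ?f ` ?S \<union> (prod.swap \<circ> ?f) ` ?S"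
  proof
    fix p assume "p \<in> {(x, z). linked Y x z \<and> c x \<noteq> c z}"
    then obtain x z y where p: "p = (x, z)" "x \<in> Y" "z \<in> Y" "x \<noteq> z" "y \<in> Y" "x + z = 2 * y" "c x \<noteq> c z"
      by (auto simp: linked_def)
    show "p \<in> ?f ` ?S \<union> (prod.swap \<circ> ?f) ` ?S"
    proof (cases "x < z")
      case True
      then have "x < y" "z = 2 * y - x" using p(6) by auto
      then have "(y, x) \<in> ?S" "p = ?f (y, x)" using p by auto
      then show ?thesis by blast
    next
      case False
      then have "z < y" "x = 2 * y - z" using p(4,6) by auto
      then have "(y, z) \<in> ?S" "p = (prod.swap \<circ> ?f) (y, z)" using p by auto
      then show ?thesis by blast
    qed
  qed
  then have "card {(x, z). linked Y x z \<and> c x \<noteq> c z} \<le> card (?f ` ?S \<union> (prod.swap \<circ> ?f) ` ?S)"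
    by (rule card_mono[rotated]) (use finY in auto)
  also have "\<dots> \<le> card (?f ` ?S) + card ((prod.swap \<circ> ?f) ` ?S)" by (rule card_Un_le)
  also have "\<dots> \<le> card ?S + card ?S"
    by (intro add_mono card_image_le) (use finY in auto)
  also have "card ?S = (\<Sum>y\<in>Y. card (?D y))" using finY by (intro card_SigmaI) auto
  finally have "real (card {(x, z). linked Y x z \<and> c x \<noteq> c z}) \<le> real ((\<Sum>y\<in>Y. card (?D y)) + (\<Sum>y\<in>Y. card (?D y)))"
    by (rule of_nat_mono)
  also have "\<dots> = 2 * (\<Sum>y\<in>Y. real (card (?D y)))" by simp
  also have "\<dots> \<le> 2 * (\<Sum>y\<in>Y. \<eta> * real n)" by (intro mult_left_mono sum_mono bad) auto
  also have "\<dots> = 2 * real (card Y) * (\<eta> * real n)" by simp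
  also have "\<dots> \<le> 2 * real n * (\<eta> * real n)"
    using card_mono[OF _ Y] \<open>\<eta> \<ge> 0\<close> by (intro mult_right_mono) auto
  finally show ?thesis by (simp add: power2_eq_square mult_ac)
qed

lemma exists_vertex_of_large_degree:
  fixes \<delta> :: real
  assumes W: "W \<subseteq> {1..n}" and "real (card {(a, d). is_3AP W a d}) \<ge> \<delta> * (real n)\<^sup>2" "n \<ge> 1"
  shows "\<exists>a\<in>{1..n}. real (card {d. is_3AP W a d}) \<ge> \<delta> * real n"
proof (rule ccontr)
  assume "\<not> ?thesis"
  then have lt: "real (card {d. is_3AP W a d}) < \<delta> * real n" if "a \<in> {1..n}" for a using that by (meson not_le)
  have "{(a, d). is_3AP W a d} = (SIGMA a:{1..n}. {d. is_3AP W a d})"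
    using W by (auto simp: is_3AP_def)
  moreover have "finite {d. is_3AP W a d}" for a
    by (rule finite_subset[of _ "{1..n}"]) (use W in \<open>fastforce simp: is_3AP_def\<close>, simp)
  ultimately have "real (card {(a, d). is_3AP W a d}) = (\<Sum>a\<in>{1..n}. real (card {d. is_3AP W a d}))"
    by (simp add: card_SigmaI)
  also have "\<dots> < (\<Sum>a\<in>{1..n}. \<delta> * real n)"
    by (rule sum_strict_mono) (use lt \<open>n \<ge> 1\<close> in auto)
  also have "\<dots> = \<delta> * (real n)\<^sup>2" by (simp add: power2_eq_square mult_ac)
  finally show False using assms(2) by simp
qed

text \<open>Greedy choice: while at least \<open>\<epsilon> * n\<close> points of \<open>X\<close>
  are undominated, some \<open>a\<close> among them begins \<open>\<delta> * n\<close> progressions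
  of undominated points. Adding \<open>a\<close> to \<open>Z\<close> dominates all their third
  terms, so the dominated set grows by \<open>\<delta> * n\<close> at every step.\<close>

lemma exists_small_dominating_set:
  fixes \<epsilon> \<delta> :: real
  assumes "\<delta> > 0" "n \<ge> 1"
    and var: "\<And>W. W \<subseteq> {1..n} \<Longrightarrow> real (card W) \<ge> \<epsilon> * real n \<Longrightarrow>
        real (card {(a, d). is_3AP W a d}) \<ge> \<delta> * (real n)\<^sup>2"
    and Y: "Y \<subseteq> {1..n}" and "X \<subseteq> Y"
  shows "\<exists>Z\<subseteq>X. finite Z \<and> card Z \<le> k \<and> (real (card {x\<in>X. \<forall>z\<in>Z. \<not> linked Y x z}) < \<epsilon> * real n \<or>
    real k * \<delta> * real n \<le> real (card {x\<in>Y. \<exists>z\<in>Z. linked Y x z}))"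
proof (induction k)
  case 0
  show ?case by (rule exI[of _ "{}"]) auto
next
  case (Suc k)
  then obtain Z where Z: "Z \<subseteq> X" "finite Z" "card Z \<le> k" and
    or: "real (card {x\<in>X. \<forall>z\<in>Z. \<not> linked Y x z}) < \<epsilon> * real n \<or>
      real k * \<delta> * real n \<le> real (card {x\<in>Y. \<exists>z\<in>Z. linked Y x z})" by blast
  let ?W = "{x\<in>X. \<forall>z\<in>Z. \<not> linked Y x z}"
  let ?N = "\<lambda>Z. {x\<in>Y. \<exists>z\<in>Z. linked Y x z}"
  show ?case
  proof (cases "real (card ?W) < \<epsilon> * real n")
    case True
    then show ?thesis using Z by (intro exI[of _ Z]) auto
  next
    case False
    have W: "?W \<subseteq> {1..n}" "?W \<subseteq> Y" using Y \<open>X \<subseteq> Y\<close> by auto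
    have "real (card {(a, d). is_3AP ?W a d}) \<ge> \<delta> * (real n)\<^sup>2"
      by (rule var[OF W(1)]) (use False in simp)
    from exists_vertex_of_large_degree[OF W(1) this \<open>n \<ge> 1\<close>]
    obtain a where a: "real (card {d. is_3AP ?W a d}) \<ge> \<delta> * real n" by blast
    let ?D = "{d. is_3AP ?W a d}"
    have "\<delta> * real n > 0" using \<open>\<delta> > 0\<close> \<open>n \<ge> 1\<close> by simp
    then have "?D \<noteq> {}" using a by (metis card.empty not_less of_nat_0)
    then have aX: "a \<in> X" by (auto simp: is_3AP_def)
    have finY: "finite Y" using Y finite_subset by blast
    let ?I = "(\<lambda>d. a + 2 * d) ` ?D"
    have "card ?I = card ?D" by (rule card_image) (simp add: inj_on_def)
    have IN: "?I \<subseteq> ?N (insert a Z) - ?N Z"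
    proof
      fix x assume "x \<in> ?I"
      then obtain d where d: "is_3AP ?W a d" "x = a + 2 * d" by blast
      then have "x \<in> ?W" "a \<in> Y" "a + d \<in> Y" "x \<noteq> a" "x + a = 2 * (a + d)" using W(2) by (auto simp: is_3AP_def)
      then have "x \<in> Y" using W(2) by blast
      then have "linked Y x a"
        unfolding linked_def using \<open>a \<in> Y\<close> \<open>a + d \<in> Y\<close> \<open>x \<noteq> a\<close> \<open>x + a = 2 * (a + d)\<close> by blast
      then show "x \<in> ?N (insert a Z) - ?N Z" using \<open>x \<in> ?W\<close> \<open>x \<in> Y\<close> by blast
    qed
    have "card ?I + card (?N Z) = card (?I \<union> ?N Z)"
      by (rule card_Un_disjoint[symmetric]) (use IN finY in \<open>auto intro: finite_subset[OF _ finY]\<close>)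
    also have "\<dots> \<le> card (?N (insert a Z))"
      by (rule card_mono) (use IN finY in auto)
    finally have "real (card ?D) + real (card (?N Z)) \<le> real (card (?N (insert a Z)))"
      using \<open>card ?I = card ?D\<close> by linarith
    moreover have "real k * \<delta> * real n \<le> real (card (?N Z))" using or False by simp
    ultimately have "real (Suc k) * \<delta> * real n \<le> real (card (?N (insert a Z)))"
      using a by (simp add: algebra_simps)
    moreover have "card (insert a Z) \<le> Suc k" using Z by (simp add: card_insert_if)
    ultimately show ?thesis using Z aX by (intro exI[of _ "insert a Z"]) auto
  qed
qed

lemma exists_predicting_set:
  fixes \<epsilon> :: real
  assumes "\<epsilon> > 0"
  shows "\<exists>\<eta>>0. \<exists>K n0. \<forall>n\<ge>n0. \<forall>Y\<subseteq>{1..n}. \<forall>c :: nat \<Rightarrow> nat.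
    (\<forall>y\<in>Y. real (card {a\<in>Y. a < y \<and> 2 * y - a \<in> Y \<and> c a \<noteq> c (2 * y - a)}) \<le> \<eta> * real n) \<longrightarrow>
    (\<exists>Z\<subseteq>Y. card Z \<le> K \<and>
      real (card {x\<in>Y. \<not> ((\<exists>z\<in>Z. linked Y x z) \<and> (\<forall>z\<in>Z. linked Y x z \<longrightarrow> c z = c x))}) \<le> \<epsilon> * real n)"
proof -
  have "\<epsilon> / 3 > 0" using assms by simp
  from varnavides[OF this] obtain \<delta> n0 where "\<delta> > 0" and
    var: "\<And>n W. n \<ge> n0 \<Longrightarrow> W \<subseteq> {1..n} \<Longrightarrow> real (card W) \<ge> \<epsilon> / 3 * real n \<Longrightarrow>
      real (card {(a, d). is_3AP W a d}) \<ge> \<delta> * (real n)\<^sup>2" by (elim exE conjE) blast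
  \<comment> \<open>\<open>K\<close> gains of \<open>\<delta> * n\<close> would dominate more than
    \<open>n\<close> points, so the greedy process must stop for lack of undominated points.\<close>
  define K where "K = nat \<lceil>1 / \<delta>\<rceil> + 1"
  have K: "real K * \<delta> > 1"
  proof -
    have "real K > 1 / \<delta>" unfolding K_def by linarith
    then show ?thesis using \<open>\<delta> > 0\<close> by (simp add: field_simps)
  qed
  have Kpos: "real K > 0" by (simp add: K_def)
  \<comment> \<open>Three sources of error get \<open>\<epsilon> / 3\<close> each: points with many
    bichromatic links (by Markov's inequality, whence \<open>\<eta>\<close>), undominated points,
    and the at most \<open>K * \<beta> * n\<close> points with a bichromatic link to
    \<open>Z\<close>.\<close>
  define \<beta> where "\<beta> = \<epsilon> / (3 * real K)"
  have \<beta>: "\<beta> > 0" "real K * \<beta> = \<epsilon> / 3" using assms Kpos by (auto simp: \<beta>_def)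
  define \<eta> where "\<eta> = \<beta> * \<epsilon> / 6"
  have "\<eta> > 0" using \<beta> assms by (simp add: \<eta>_def)
  have main: "\<exists>Z\<subseteq>Y. card Z \<le> K \<and>
      real (card {x\<in>Y. \<not> ((\<exists>z\<in>Z. linked Y x z) \<and> (\<forall>z\<in>Z. linked Y x z \<longrightarrow> c z = c x))}) \<le> \<epsilon> * real n"
    if n: "n \<ge> max n0 1" and Y: "Y \<subseteq> {1..n}"
      and bad: "\<And>y. y \<in> Y \<Longrightarrow> real (card {a\<in>Y. a < y \<and> 2 * y - a \<in> Y \<and> c a \<noteq> c (2 * y - a)}) \<le> \<eta> * real n"
    for n Y and c :: "nat \<Rightarrow> nat"
  proof -
    have finY: "finite Y" using Y finite_subset by blast
    have n1: "n \<ge> 1" "n \<ge> n0" using n by auto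
    let ?B = "\<lambda>z. {x. linked Y x z \<and> c x \<noteq> c z}"
    have finB: "finite (?B z)" for z by (rule finite_subset[OF _ finY]) (auto simp: linked_def)
    \<comment> \<open>Predictors are taken only from \<open>X\<close>, so that each misleads at most
      \<open>\<beta> * n\<close> points.\<close>
    define X where "X = {z\<in>Y. real (card (?B z)) \<le> \<beta> * real n}"
    have "X \<subseteq> Y" by (auto simp: X_def)
    have finX: "finite X" using \<open>X \<subseteq> Y\<close> finY finite_subset by blast
    have YX: "real (card (Y - X)) \<le> \<epsilon> / 3 * real n"
    proof -
      have "real (card (Y - X)) * (\<beta> * real n) = (\<Sum>z\<in>Y - X. \<beta> * real n)" by simp
      also have "\<dots> \<le> (\<Sum>z\<in>Y - X. real (card (?B z)))" by (rule sum_mono) (auto simp: X_def)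
      also have "\<dots> \<le> (\<Sum>z\<in>Y. real (card (?B z)))" by (rule sum_mono2) (use finY in auto)
      also have "\<dots> = real (card (SIGMA z:Y. ?B z))" using finY finB by (simp add: card_SigmaI)
      also have "(SIGMA z:Y. ?B z) = {(x, z). linked Y x z \<and> c x \<noteq> c z}"
        by (auto simp: linked_def add.commute)
      also have "real (card \<dots>) \<le> 2 * \<eta> * (real n)\<^sup>2"
        by (rule card_linked_bichromatic_le[OF Y]) (use \<open>\<eta> > 0\<close> bad in auto)
      also have "\<dots> = \<epsilon> / 3 * real n * (\<beta> * real n)" by (simp add: \<eta>_def power2_eq_square)
      finally show ?thesis using \<beta> n1 by simp
    qed
    have "\<exists>Z\<subseteq>X. finite Z \<and> card Z \<le> K \<and> (real (card {x\<in>X. \<forall>z\<in>Z. \<not> linked Y x z}) < \<epsilon> / 3 * real n \<or>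
        real K * \<delta> * real n \<le> real (card {x\<in>Y. \<exists>z\<in>Z. linked Y x z}))"
      by (rule exists_small_dominating_set[OF \<open>\<delta> > 0\<close> n1(1) _ Y \<open>X \<subseteq> Y\<close>]) (rule var[OF n1(2)])
    then obtain Z where Z: "Z \<subseteq> X" "finite Z" "card Z \<le> K" and
      or: "real (card {x\<in>X. \<forall>z\<in>Z. \<not> linked Y x z}) < \<epsilon> / 3 * real n \<or>
        real K * \<delta> * real n \<le> real (card {x\<in>Y. \<exists>z\<in>Z. linked Y x z})" by (elim exE conjE)
    have "card {x\<in>Y. \<exists>z\<in>Z. linked Y x z} \<le> card {1..n}" by (rule card_mono) (use Y in auto)
    then have "real (card {x\<in>Y. \<exists>z\<in>Z. linked Y x z}) \<le> real n" by simp
    moreover have "real n < real K * \<delta> * real n" using K n1 by simp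
    ultimately have XZ: "real (card {x\<in>X. \<forall>z\<in>Z. \<not> linked Y x z}) < \<epsilon> / 3 * real n" using or by linarith
    let ?E = "{x\<in>Y. \<not> ((\<exists>z\<in>Z. linked Y x z) \<and> (\<forall>z\<in>Z. linked Y x z \<longrightarrow> c z = c x))}"
    have "?E \<subseteq> (Y - X) \<union> {x\<in>X. \<forall>z\<in>Z. \<not> linked Y x z} \<union> (\<Union>z\<in>Z. ?B z)"
      by auto
    then have "card ?E \<le> card ((Y - X) \<union> {x\<in>X. \<forall>z\<in>Z. \<not> linked Y x z} \<union> (\<Union>z\<in>Z. ?B z))"
      by (rule card_mono[rotated]) (use finY finX Z(2) finB in auto)
    also have "\<dots> \<le> card (Y - X) + card {x\<in>X. \<forall>z\<in>Z. \<not> linked Y x z} + (\<Sum>z\<in>Z. card (?B z))"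
      by (intro order.trans[OF card_Un_le] add_mono card_UN_le Z(2) order_refl)
    finally have "real (card ?E) \<le> real (card (Y - X) + card {x\<in>X. \<forall>z\<in>Z. \<not> linked Y x z} + (\<Sum>z\<in>Z. card (?B z)))"
      by (rule of_nat_mono)
    then have E: "real (card ?E) \<le> real (card (Y - X)) + real (card {x\<in>X. \<forall>z\<in>Z. \<not> linked Y x z}) + (\<Sum>z\<in>Z. real (card (?B z)))"
      by (simp only: of_nat_add of_nat_sum)
    have "(\<Sum>z\<in>Z. real (card (?B z))) \<le> (\<Sum>z\<in>Z. \<beta> * real n)"
      by (rule sum_mono) (use Z in \<open>auto simp: X_def\<close>)
    also have "\<dots> = real (card Z) * (\<beta> * real n)" by simp
    also have "\<dots> \<le> real K * (\<beta> * real n)" using Z(3) \<beta> by (intro mult_right_mono) auto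
    also have "\<dots> = \<epsilon> / 3 * real n" using \<beta>(2) by (simp add: mult.assoc[symmetric])
    finally have "real (card ?E) \<le> \<epsilon> * real n" using E YX XZ by linarith
    then show ?thesis using Z \<open>X \<subseteq> Y\<close> by (intro exI[of _ Z]) auto
  qed
  show ?thesis
    by (rule exI[of _ \<eta>], intro conjI exI[of _ K] exI[of _ "max n0 1"] allI impI main \<open>\<eta> > 0\<close>) auto
qed

section \<open>Samples and the lists they determine\<close>

definition hits :: "nat set \<Rightarrow> (nat \<Rightarrow> nat) \<Rightarrow> nat \<Rightarrow> nat \<Rightarrow> bool" where
  "hits A p x a \<longleftrightarrow> a \<in> A \<and> a < x \<and> 2 * x - a \<in> A \<and> p a \<noteq> 0 \<and> p (2 * x - a) \<noteq> 0 \<and> p a \<noteq> p (2 * x - a)"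

definition unhit :: "nat set \<Rightarrow> (nat \<Rightarrow> nat) \<Rightarrow> nat set" where
  "unhit A p = {x\<in>A. \<forall>a. \<not> hits A p x a}"

text \<open>Built from \<open>A\<close>, \<open>p\<close> and \<open>q\<close> alone: a colouring
  enters only through its samples, so the number of sparse pairs \<open>p\<close>, \<open>q\<close>
  bounds the number of templates. \<open>SOME\<close> makes the selected pair or predictor a
  function of this data.\<close>

definition template :: "nat set \<Rightarrow> (nat \<Rightarrow> nat) \<Rightarrow> (nat \<Rightarrow> nat) \<Rightarrow> nat \<Rightarrow> nat set" where
  "template A p q x =
    (if \<exists>a. hits A p x a then (let a = SOME a. hits A p x a in {p a, p (2 * x - a)})
     else if \<exists>z. q z \<noteq> 0 \<and> linked (unhit A p) x z then {q (SOME z. q z \<noteq> 0 \<and> linked (unhit A p) x z)}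
     else {})"

lemma finite_template: "finite (template A p q x)"
  and card_template_le: "card (template A p q x) \<le> 2"
  by (auto simp: template_def Let_def card_insert_if)

text \<open>\<open>x\<close> is the middle term of the progression from \<open>a\<close> to
  \<open>2 * x - a\<close>, whose ends differ in colour.\<close>

lemma template_hit:
  assumes free: "rainbow_3AP_free A c" and p: "\<And>y. y \<in> A \<Longrightarrow> p y \<noteq> 0 \<Longrightarrow> p y = c y"
    and "x \<in> A" "\<exists>a. hits A p x a"
  shows "c x \<in> template A p q x"
proof -
  define a where "a = (SOME a. hits A p x a)"
  have a: "hits A p x a" unfolding a_def using assms(4) by (rule someI_ex)
  then have "is_3AP A a (x - a)" and eq: "a + 2 * (x - a) = 2 * x - a" "a + (x - a) = x"
    using \<open>x \<in> A\<close> by (auto simp: is_3AP_def hits_def diff_mult_distrib2)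
  then have "\<not> rainbow_3AP c a (x - a)" using free by (auto simp: rainbow_3AP_free_def)
  moreover have "p a = c a" "p (2 * x - a) = c (2 * x - a)" "p a \<noteq> p (2 * x - a)"
    using a p by (auto simp: hits_def)
  ultimately have "c x \<in> {p a, p (2 * x - a)}" unfolding rainbow_3AP_def eq by auto
  then show ?thesis using assms(4) by (simp add: template_def Let_def a_def)
qed

definition sampled :: "nat \<Rightarrow> (nat \<Rightarrow> nat) \<Rightarrow> nat set \<Rightarrow> nat \<Rightarrow> nat" where
  "sampled n c S = (\<lambda>x\<in>{1..n}. if x \<in> S then c x else 0)"

lemma sampled_mem_sparse_colorings:
  assumes "c \<in> colorings r A" "S \<subseteq> A" "A \<subseteq> {1..n}" "card S \<le> k"
  shows "sampled n c S \<in> sparse_colorings r n k"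
proof -
  have "{x \<in> {1..n}. sampled n c S x \<noteq> 0} \<subseteq> S" by (auto simp: sampled_def split: if_splits)
  moreover have "finite S" using finite_subset[OF order.trans[OF assms(2,3)]] by simp
  ultimately have "card {x \<in> {1..n}. sampled n c S x \<noteq> 0} \<le> card S" by (intro card_mono)
  moreover have "sampled n c S \<in> {1..n} \<rightarrow>\<^sub>E {0..r}"
  proof
    fix x assume "x \<in> {1..n}"
    moreover have "x \<in> S \<Longrightarrow> c x \<in> {1..r}" using assms(1,2) by (auto simp: colorings_def)
    ultimately show "sampled n c S x \<in> {0..r}" by (auto simp: sampled_def)
  qed (auto simp: sampled_def)
  ultimately show ?thesis using assms(4) by (simp add: sparse_colorings_def)
qed

lemma sampled_apply:
  assumes "c \<in> colorings r A" "S \<subseteq> A" "A \<subseteq> {1..n}"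
  shows "x \<in> S \<Longrightarrow> sampled n c S x = c x" and "x \<in> S \<Longrightarrow> c x > 0"
    and "x \<in> A \<Longrightarrow> x \<notin> S \<Longrightarrow> sampled n c S x = 0"
proof -
  show "x \<in> S \<Longrightarrow> c x > 0" using PiE_mem[of c A "\<lambda>_. {1..r}" x] assms(1,2) by (auto simp: colorings_def)
  show "x \<in> S \<Longrightarrow> sampled n c S x = c x" "x \<in> A \<Longrightarrow> x \<notin> S \<Longrightarrow> sampled n c S x = 0"
    using assms(2,3) by (auto simp: sampled_def)
qed

text \<open>Errors are unavoidable: a point \<open>x\<close> whose symmetric pairs are almost all
  monochromatic may have every colour. On the set of these points \<open>c\<close> is almost constant along
  \<^term>\<open>linked\<close> pairs, so a bounded number of sampled colours predicts it up to few errors.\<close>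

lemma exists_template:
  fixes \<epsilon> :: real
  assumes "\<epsilon> > 0"
  shows "\<exists>n0. \<forall>n\<ge>n0. \<forall>A\<subseteq>{1..n}. \<forall>c\<in>colorings r A. rainbow_3AP_free A c \<longrightarrow>
    (\<exists>S\<subseteq>A. \<exists>Z\<subseteq>A. real (card S) \<le> \<epsilon> * real n \<and> real (card Z) \<le> \<epsilon> * real n \<and>
      real (card {x\<in>A. c x \<notin> template A (sampled n c S) (sampled n c Z) x}) \<le> \<epsilon> * real n)"
proof -
  obtain \<eta> K n1 where "\<eta> > 0" and predict: "\<forall>n\<ge>n1. \<forall>Y\<subseteq>{1..n}. \<forall>c :: nat \<Rightarrow> nat.
    (\<forall>y\<in>Y. real (card {a\<in>Y. a < y \<and> 2 * y - a \<in> Y \<and> c a \<noteq> c (2 * y - a)}) \<le> \<eta> * real n) \<longrightarrow>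
    (\<exists>Z\<subseteq>Y. card Z \<le> K \<and>
      real (card {x\<in>Y. \<not> ((\<exists>z\<in>Z. linked Y x z) \<and> (\<forall>z\<in>Z. linked Y x z \<longrightarrow> c z = c x))}) \<le> \<epsilon> * real n)"
    using exists_predicting_set[OF assms] by (elim exE conjE)
  define M where "M = max 2 (nat \<lceil>1 / \<epsilon>\<rceil>)"
  have M: "M \<ge> 2" "1 / real M \<le> \<epsilon>"
  proof -
    have "real M \<ge> 1 / \<epsilon>" unfolding M_def by linarith
    moreover have "real M > 0" by (simp add: M_def)
    ultimately show "1 / real M \<le> \<epsilon>" using assms by (simp add: field_simps)
  qed (simp add: M_def)
  obtain n2 where hit: "\<forall>n\<ge>n2. \<forall>D. (\<forall>x. D x \<subseteq> {a\<in>{1..n}. a < x \<and> 2 * x - a \<in> {1..n}}) \<longrightarrow>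
    (\<exists>S\<subseteq>{1..n}. real (card S) \<le> real n / real M \<and>
      (\<forall>x\<in>{1..n}. real (card (D x)) \<ge> \<eta> * real n \<longrightarrow> (\<exists>a\<in>D x. a \<in> S \<and> 2 * x - a \<in> S)))"
    using exists_sparse_set_hitting_pairs[OF \<open>\<eta> > 0\<close> M(1)] by (elim exE)
  \<comment> \<open>The last entry makes the bounded number \<open>K\<close> of predictors at most
    \<open>\<epsilon> * n\<close>.\<close>
  define n0 where "n0 = max (max n1 n2) (nat \<lceil>real K / \<epsilon>\<rceil>)"
  have main: "\<exists>S\<subseteq>A. \<exists>Z\<subseteq>A. real (card S) \<le> \<epsilon> * real n \<and> real (card Z) \<le> \<epsilon> * real n \<and>
      real (card {x\<in>A. c x \<notin> template A (sampled n c S) (sampled n c Z) x}) \<le> \<epsilon> * real n"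
    if n: "n \<ge> n0" and A: "A \<subseteq> {1..n}" and c: "c \<in> colorings r A" and free: "rainbow_3AP_free A c" for n A c
  proof -
    have n12: "n \<ge> n1" "n \<ge> n2" and "real n \<ge> real K / \<epsilon>"
      using n unfolding n0_def by linarith+
    then have K: "real K \<le> \<epsilon> * real n" using assms by (simp add: field_simps)
    let ?D = "\<lambda>x. {a\<in>A. a < x \<and> 2 * x - a \<in> A \<and> c a \<noteq> c (2 * x - a)}"
    have finA: "finite A" using A finite_subset by blast
    have "\<forall>x. ?D x \<subseteq> {a\<in>{1..n}. a < x \<and> 2 * x - a \<in> {1..n}}" using A by auto
    from hit[rule_format, OF n12(2) this[rule_format]] obtain S0 where
      S0: "S0 \<subseteq> {1..n}" "real (card S0) \<le> real n / real M" and
      hitS: "\<And>x. x \<in> {1..n} \<Longrightarrow> real (card (?D x)) \<ge> \<eta> * real n \<Longrightarrow> \<exists>a\<in>?D x. a \<in> S0 \<and> 2 * x - a \<in> S0" by blast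
    define S where "S = S0 \<inter> A"
    have "S \<subseteq> A" by (simp add: S_def)
    define p where "p = sampled n c S"
    note sam = sampled_apply[OF c \<open>S \<subseteq> A\<close> A, folded p_def]
    define Y where "Y = unhit A p"
    have YA: "Y \<subseteq> A" by (auto simp: Y_def unhit_def)
    have finY: "finite Y" using finA YA finite_subset by blast
    \<comment> \<open>With more bichromatic pairs around \<open>y\<close>, the sparse set would
      contain one of them, and \<open>y\<close> would be hit.\<close>
    have Ybad: "real (card {a\<in>Y. a < y \<and> 2 * y - a \<in> Y \<and> c a \<noteq> c (2 * y - a)}) \<le> \<eta> * real n" if "y \<in> Y" for y
    proof (rule ccontr)
      assume "\<not> ?thesis"
      then have "\<eta> * real n \<le> real (card {a\<in>Y. a < y \<and> 2 * y - a \<in> Y \<and> c a \<noteq> c (2 * y - a)})" by simp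
      also have "\<dots> \<le> real (card (?D y))"
        by (intro of_nat_mono card_mono) (use YA finA in auto)
      finally have "\<eta> * real n \<le> real (card (?D y))" .
      moreover have "y \<in> {1..n}" using that YA A by blast
      ultimately obtain a where a: "a \<in> ?D y" "a \<in> S0" "2 * y - a \<in> S0" using hitS[of y] by blast
      then have "a \<in> S" "2 * y - a \<in> S" by (auto simp: S_def)
      then have "hits A p y a" using a(1) by (simp add: hits_def sam)
      then show False using that by (auto simp: Y_def unhit_def)
    qed
    have "Y \<subseteq> {1..n}" using YA A by blast
    from predict[rule_format, OF n12(1) this Ybad] obtain Z where Z: "Z \<subseteq> Y" "card Z \<le> K" and
      err: "real (card {x\<in>Y. \<not> ((\<exists>z\<in>Z. linked Y x z) \<and> (\<forall>z\<in>Z. linked Y x z \<longrightarrow> c z = c x))}) \<le> \<epsilon> * real n"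
      by blast
    have "Z \<subseteq> A" using Z(1) YA by blast
    define q where "q = sampled n c Z"
    note samq = sampled_apply[OF c \<open>Z \<subseteq> A\<close> A, folded q_def]
    \<comment> \<open>Hit points never fail, so all errors lie in \<open>Y\<close>; there the
      template fails only where \<open>Z\<close> does not predict \<open>c x\<close>.\<close>
    have "{x\<in>A. c x \<notin> template A p q x} \<subseteq>
        {x\<in>Y. \<not> ((\<exists>z\<in>Z. linked Y x z) \<and> (\<forall>z\<in>Z. linked Y x z \<longrightarrow> c z = c x))}"
    proof
      fix x assume "x \<in> {x\<in>A. c x \<notin> template A p q x}"
      then have x: "x \<in> A" "c x \<notin> template A p q x" by auto
      have nohit: "\<not> (\<exists>a. hits A p x a)"
      proof
        assume hit_x: "\<exists>a. hits A p x a"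
        have "c x \<in> template A p q x"
          by (rule template_hit[OF free _ x(1) hit_x]) (metis sam(1,3))
        then show False using x(2) by simp
      qed
      then have "x \<in> Y" using x(1) by (auto simp: Y_def unhit_def)
      moreover have False if ex: "\<exists>z\<in>Z. linked Y x z" and all: "\<forall>z\<in>Z. linked Y x z \<longrightarrow> c z = c x"
      proof -
        define z where "z = (SOME z. q z \<noteq> 0 \<and> linked (unhit A p) x z)"
        have ex': "\<exists>z. q z \<noteq> 0 \<and> linked (unhit A p) x z"
          using ex samq(1,2) by (metis Y_def less_irrefl)
        then have z: "q z \<noteq> 0" "linked Y x z"
          unfolding z_def Y_def using someI_ex[OF ex'] by blast+
        \<comment> \<open>\<open>q\<close> vanishes on \<open>A\<close> outside \<open>Z\<close>, so
          the selected \<open>z\<close> is a genuine predictor.\<close>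
        then have "z \<in> A" using YA by (auto simp: linked_def)
        then have "z \<in> Z" using samq(3)[of z] z(1) by blast
        then have "q z = c x" using all z(2) by (simp add: samq(1))
        moreover have "template A p q x = {q z}" using nohit ex' by (simp add: template_def z_def)
        ultimately show False using x(2) by simp
      qed
      ultimately show "x \<in> {x\<in>Y. \<not> ((\<exists>z\<in>Z. linked Y x z) \<and> (\<forall>z\<in>Z. linked Y x z \<longrightarrow> c z = c x))}"
        by blast
    qed
    then have "card {x\<in>A. c x \<notin> template A p q x} \<le>
        card {x\<in>Y. \<not> ((\<exists>z\<in>Z. linked Y x z) \<and> (\<forall>z\<in>Z. linked Y x z \<longrightarrow> c z = c x))}"
      by (rule card_mono[rotated]) (use finY in simp)
    then have "real (card {x\<in>A. c x \<notin> template A p q x}) \<le> \<epsilon> * real n" using err by linarith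
    moreover have "real (card S) \<le> \<epsilon> * real n"
    proof -
      have "card S \<le> card S0" unfolding S_def by (rule card_mono) (use finite_subset[OF S0(1)] in auto)
      then have "real (card S) \<le> 1 / real M * real n" using S0(2) by simp
      also have "\<dots> \<le> \<epsilon> * real n" by (rule mult_right_mono[OF M(2)]) simp
      finally show ?thesis .
    qed
    moreover have "real (card Z) \<le> \<epsilon> * real n" using Z(2) K by linarith
    ultimately show ?thesis
      using \<open>S \<subseteq> A\<close> \<open>Z \<subseteq> A\<close> unfolding p_def q_def by blast
  qed
  show ?thesis by (intro exI[of _ n0] allI impI ballI main)
qed

text \<open>An assignment is coded by three sparse functions: the sample \<open>p\<close>, the
  predictors \<open>q\<close>, and \<open>s\<close>, which records the true colours at the
  exceptional points. Each contributes a factor of at most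
  \<open>2 powr (\<theta> / 3 * n)\<close>.\<close>

theorem exists_list_assignments:
  fixes \<theta> :: real
  assumes "\<theta> > 0"
  shows "\<exists>n0. \<forall>n\<ge>n0. \<forall>A\<subseteq>{1..n}. \<exists>\<L> :: (nat \<Rightarrow> nat set) set.
    finite \<L> \<and> real (card \<L>) \<le> 2 powr (\<theta> * real n) \<and> (\<forall>L\<in>\<L>. \<forall>x. finite (L x) \<and> card (L x) \<le> 2) \<and>
    (\<forall>c\<in>colorings r A. rainbow_3AP_free A c \<longrightarrow> (\<exists>L\<in>\<L>. c \<in> PiE A L))"
proof -
  have "\<theta> / 3 > 0" using assms by simp
  from card_sparse_colorings_le[OF this, of r] obtain \<epsilon> where "\<epsilon> > 0" and
    sparse: "\<And>n k. real k \<le> \<epsilon> * real n \<Longrightarrow> real (card (sparse_colorings r n k)) \<le> 2 powr (\<theta> / 3 * real n)"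
    by blast
  from exists_template[OF \<open>\<epsilon> > 0\<close>, of r] obtain n0 where
    tmpl: "\<forall>n\<ge>n0. \<forall>A\<subseteq>{1..n}. \<forall>c\<in>colorings r A. rainbow_3AP_free A c \<longrightarrow>
    (\<exists>S\<subseteq>A. \<exists>Z\<subseteq>A. real (card S) \<le> \<epsilon> * real n \<and> real (card Z) \<le> \<epsilon> * real n \<and>
      real (card {x\<in>A. c x \<notin> template A (sampled n c S) (sampled n c Z) x}) \<le> \<epsilon> * real n)"
    by (elim exE)
  have main: "\<exists>\<L> :: (nat \<Rightarrow> nat set) set. finite \<L> \<and> real (card \<L>) \<le> 2 powr (\<theta> * real n) \<and> (\<forall>L\<in>\<L>. \<forall>x. finite (L x) \<and> card (L x) \<le> 2) \<and>
    (\<forall>c\<in>colorings r A. rainbow_3AP_free A c \<longrightarrow> (\<exists>L\<in>\<L>. c \<in> PiE A L))"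
    if n: "n \<ge> n0" and A: "A \<subseteq> {1..n}" for n A
  proof -
    define k where "k = nat \<lfloor>\<epsilon> * real n\<rfloor>"
    have k: "real k \<le> \<epsilon> * real n" unfolding k_def using \<open>\<epsilon> > 0\<close> by simp
    have le_k: "m \<le> k" if "real m \<le> \<epsilon> * real n" for m
      using that unfolding k_def by linarith
    let ?Sp = "sparse_colorings r n k"
    define L where "L = (\<lambda>(p, q, s) x. if s x \<noteq> (0::nat) then {s x} else template A p q x)"
    let ?\<L> = "L ` (?Sp \<times> ?Sp \<times> ?Sp)"
    have fin: "finite ?\<L>" using finite_sparse_colorings by auto
    have "card ?\<L> \<le> card (?Sp \<times> ?Sp \<times> ?Sp)"
      by (rule card_image_le) (use finite_sparse_colorings in auto)
    then have "real (card ?\<L>) \<le> real (card ?Sp) ^ 3"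
      by (simp add: card_cartesian_product power3_eq_cube flip: of_nat_mult)
    also have "\<dots> \<le> (2 powr (\<theta> / 3 * real n)) ^ 3"
      by (rule power_mono[OF sparse[OF k]]) simp
    also have "\<dots> = 2 powr (\<theta> * real n)" by (simp add: powr_power)
    finally have card: "real (card ?\<L>) \<le> 2 powr (\<theta> * real n)" .
    have two: "finite (F x) \<and> card (F x) \<le> 2" if "F \<in> ?\<L>" for F x
      using that by (auto simp: L_def finite_template card_template_le)
    have ex: "\<exists>F\<in>?\<L>. c \<in> PiE A F" if c: "c \<in> colorings r A" and free: "rainbow_3AP_free A c" for c
    proof -
      from tmpl[rule_format, OF n A c free] obtain S Z where SZ: "S \<subseteq> A" "Z \<subseteq> A"
        "real (card S) \<le> \<epsilon> * real n" "real (card Z) \<le> \<epsilon> * real n"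
        "real (card {x\<in>A. c x \<notin> template A (sampled n c S) (sampled n c Z) x}) \<le> \<epsilon> * real n" by blast
      let ?p = "sampled n c S" and ?q = "sampled n c Z"
      let ?E = "{x\<in>A. c x \<notin> template A ?p ?q x}"
      let ?s = "sampled n c ?E"
      have "?p \<in> ?Sp" "?q \<in> ?Sp" "?s \<in> ?Sp"
        by (intro sampled_mem_sparse_colorings[OF c _ A] le_k SZ; auto)+
      then have "L (?p, ?q, ?s) \<in> ?\<L>" by blast
      moreover have "c \<in> PiE A (L (?p, ?q, ?s))"
      proof
        fix x assume x: "x \<in> A"
        have E: "?E \<subseteq> A" by auto
        show "c x \<in> L (?p, ?q, ?s) x"
        proof (cases "x \<in> ?E")
          case True
          then show ?thesis using sampled_apply(1,2)[OF c E A True] by (simp add: L_def)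
        next
          case False
          then show ?thesis using sampled_apply(3)[OF c E A x] x by (simp add: L_def)
        qed
      next
        fix x assume "x \<notin> A"
        then show "c x = undefined" using c by (auto simp: colorings_def)
      qed
      ultimately show ?thesis by blast
    qed
    have "\<forall>F\<in>?\<L>. \<forall>x. finite (F x) \<and> card (F x) \<le> 2" by (intro ballI allI two)
    moreover have "\<forall>c\<in>colorings r A. rainbow_3AP_free A c \<longrightarrow> (\<exists>F\<in>?\<L>. c \<in> PiE A F)"
      by (intro ballI impI ex)
    ultimately show ?thesis using fin card by (intro exI[of _ ?\<L>] conjI)
  qed
  show ?thesis by (intro exI[of _ n0] allI impI main)
qed

section \<open>Colourings with three colours\<close>

lemma exists_maximal_disjoint_subfamily:
  assumes "finite F"
  shows "\<exists>I\<subseteq>F. (\<forall>i\<in>I. \<forall>j\<in>I. i \<noteq> j \<longrightarrow> b i \<inter> b j = {}) \<and>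
    (\<forall>i\<in>F. b i \<inter> (\<Union>j\<in>I. b j) = {} \<longrightarrow> i \<in> I)"
proof -
  let ?\<F> = "{I\<in>Pow F. \<forall>i\<in>I. \<forall>j\<in>I. i \<noteq> j \<longrightarrow> b i \<inter> b j = {}}"
  have "finite ?\<F>" using assms by simp
  moreover have "{} \<in> ?\<F>" by simp
  ultimately obtain I where I: "I \<in> ?\<F>" and max: "\<And>J. J \<in> ?\<F> \<Longrightarrow> I \<subseteq> J \<Longrightarrow> I = J"
    by (metis (no_types, lifting) finite_has_maximal empty_iff)
  have "i \<in> I" if "i \<in> F" "b i \<inter> (\<Union>j\<in>I. b j) = {}" for i
  proof -
    have "b i \<inter> b j = {}" "b j \<inter> b i = {}" if "j \<in> I" for j
      using \<open>b i \<inter> (\<Union>j\<in>I. b j) = {}\<close> that by blast+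
    then have "insert i I \<in> ?\<F>" using I that(1) by auto
    then show ?thesis using max[of "insert i I"] by blast
  qed
  then show ?thesis using I by (intro exI[of _ I]) auto
qed

text \<open>Two points of the same parity are joined through a third one such that both midpoints are
  present; the two parity classes are joined by three consecutive points.\<close>

lemma constant_of_constant_on_3APs:
  assumes B: "B \<subseteq> {1..n}" and missing: "real (card ({1..n} - B)) \<le> real n / 100" and n: "n \<ge> 100"
    and const: "\<And>a d. is_3AP B a d \<Longrightarrow> f a = f (a + d) \<and> f (a + d) = f (a + 2 * d)"
    and "x \<in> B" "y \<in> B"
  shows "f x = f y"
proof -
  let ?C = "{1..n} - B"
  have mid: "f x = f y" if "x \<in> B" "y \<in> B" "m \<in> B" "x + y = 2 * m" for x y m
  proof -
    have *: "f x = f y" if "x \<in> B" "y \<in> B" "m \<in> B" "x + y = 2 * m" "x < y" for x y m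
    proof -
      have "x < m" "x + (m - x) = m" "x + 2 * (m - x) = y" using that by auto
      then have "is_3AP B x (m - x)" using that by (simp add: is_3AP_def)
      from const[OF this] show ?thesis using \<open>x + (m - x) = m\<close> \<open>x + 2 * (m - x) = y\<close> by simp
    qed
    show ?thesis
    proof (cases x y rule: linorder_cases)
      case less
      then show ?thesis using *[of x y m] that by blast
    next
      case greater
      then show ?thesis using *[of y x m] that by (simp add: add.commute)
    qed simp
  qed
  have same: "f x = f y" if xy: "x \<in> B" "y \<in> B" and par: "x mod 2 = y mod 2" for x y
  proof -
    \<comment> \<open>Candidates for the third point \<open>z\<close>: at least
      \<open>n div 2\<close> of them, while the requirements on \<open>z\<close> and the two
      midpoints exclude at most \<open>3 * card ?C\<close>.\<close>
    let ?P = "{z\<in>{1..n}. z mod 2 = x mod 2}"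
    let ?M = "\<lambda>w. {z\<in>?P. (w + z) div 2 \<in> ?C}"
    have "(\<lambda>z. 2 * z - x mod 2) ` {1..n div 2} \<subseteq> ?P"
    proof
      fix t assume "t \<in> (\<lambda>z. 2 * z - x mod 2) ` {1..n div 2}"
      then obtain z where z: "t = 2 * z - x mod 2" "1 \<le> z" "z \<le> n div 2" by auto
      have "1 \<le> 2 * z - x mod 2 \<and> 2 * z - x mod 2 \<le> n \<and> (2 * z - x mod 2) mod 2 = x mod 2"
      proof (cases "x mod 2 = 0")
        case True
        then show ?thesis using z(2,3) by simp
      next
        case False
        then have "x mod 2 = 1" by simp
        moreover have "(2 * z - 1) mod 2 = 1" using z(2) by presburger
        moreover have "1 \<le> 2 * z - 1 \<and> 2 * z - 1 \<le> n" using z(2,3) by linarith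
        ultimately show ?thesis by simp
      qed
      then show "t \<in> ?P" using z(1) by simp
    qed
    from card_mono[OF _ this] have "card ((\<lambda>z. 2 * z - x mod 2) ` {1..n div 2}) \<le> card ?P" by simp
    moreover have "card ((\<lambda>z. 2 * z - x mod 2) ` {1..n div 2}) = n div 2"
    proof (subst card_image)
      show "inj_on (\<lambda>z. 2 * z - x mod 2) {1..n div 2}"
      proof (rule inj_onI)
        fix z w assume "z \<in> {1..n div 2}" "w \<in> {1..n div 2}" "2 * z - x mod 2 = 2 * w - x mod 2"
        then have "1 \<le> z" "1 \<le> w" "2 * z - x mod 2 = 2 * w - x mod 2" by auto
        moreover have "x mod 2 \<le> 1" by simp
        ultimately show "z = w" by linarith
      qed
    qed simp
    ultimately have cP: "n div 2 \<le> card ?P" by simp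
    \<comment> \<open>For \<open>z\<close> of the same parity as \<open>w\<close>, the midpoint
      determines \<open>z\<close>.\<close>
    have cM: "card (?M w) \<le> card ?C" if "w mod 2 = x mod 2" for w
    proof (rule card_inj_on_le)
      show "inj_on (\<lambda>z. (w + z) div 2) (?M w)"
      proof (rule inj_onI)
        fix z v assume "z \<in> ?M w" "v \<in> ?M w" "(w + z) div 2 = (w + v) div 2"
        then have par: "z mod 2 = w mod 2" "v mod 2 = w mod 2" and eq: "(w + z) div 2 = (w + v) div 2"
          using that by auto
        have "w + z = 2 * ((w + z) div 2)" using par(1) by presburger
        moreover have "w + v = 2 * ((w + v) div 2)" using par(2) by presburger
        ultimately show "z = v" using eq by linarith
      qed
    qed auto
    have "\<exists>z\<in>?P. z \<in> B \<and> (x + z) div 2 \<notin> ?C \<and> (y + z) div 2 \<notin> ?C"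
    proof (rule ccontr)
      assume "\<not> ?thesis"
      then have "?P \<subseteq> ?C \<union> ?M x \<union> ?M y" by auto
      then have "card ?P \<le> card (?C \<union> ?M x \<union> ?M y)" by (rule card_mono[rotated]) auto
      also have "\<dots> \<le> card ?C + card (?M x) + card (?M y)"
        by (intro order.trans[OF card_Un_le] add_mono order_refl)
      also have "\<dots> \<le> 3 * card ?C" using cM[of x] cM[of y] par by simp
      finally have "real (n div 2) \<le> 3 * real (card ?C)" using cP by linarith
      then show False using missing n by linarith
    qed
    then obtain z where z: "z \<in> B" "z mod 2 = x mod 2" "(x + z) div 2 \<notin> ?C" "(y + z) div 2 \<notin> ?C" by auto
    have "x \<le> n" "y \<le> n" "z \<le> n" "1 \<le> x" "1 \<le> y" "1 \<le> z" using xy z(1) B by auto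
    then have "(x + z) div 2 \<in> {1..n}" "(y + z) div 2 \<in> {1..n}" by auto
    then have "(x + z) div 2 \<in> B" "(y + z) div 2 \<in> B" using z by auto
    moreover have "x + z = 2 * ((x + z) div 2)" "y + z = 2 * ((y + z) div 2)" using z(2) par by presburger+
    ultimately show ?thesis using mid xy z(1) by metis
  qed
  \<comment> \<open>Otherwise every triple of consecutive points meets \<open>?C\<close>, and a
    point of \<open>?C\<close> lies in at most three of them.\<close>
  have "\<exists>a\<in>{1..n - 2}. a \<in> B \<and> a + 1 \<in> B \<and> a + 2 \<in> B"
  proof (rule ccontr)
    assume none: "\<not> ?thesis"
    let ?Q = "\<lambda>i. {a\<in>{1..n - 2}. a + i \<in> ?C}"
    have cQ: "card (?Q i) \<le> card ?C" for i
      by (rule card_inj_on_le[of "\<lambda>a. a + i"]) (auto simp: inj_on_def)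
    have "{1..n - 2} \<subseteq> ?Q 0 \<union> ?Q 1 \<union> ?Q 2" using none by fastforce
    then have "card {1..n - 2} \<le> card (?Q 0 \<union> ?Q 1 \<union> ?Q 2)" by (rule card_mono[rotated]) auto
    also have "\<dots> \<le> card (?Q 0) + card (?Q 1) + card (?Q 2)"
      by (intro order.trans[OF card_Un_le] add_mono order_refl)
    also have "\<dots> \<le> 3 * card ?C" using cQ[of 0] cQ[of 1] cQ[of 2] by linarith
    finally have "real (n - 2) \<le> 3 * real (card ?C)" by simp
    then show False using missing n by linarith
  qed
  then obtain a where a: "a \<in> B" "a + 1 \<in> B" "a + 2 \<in> B" by blast
  then have "f a = f (a + 1)" using const[of a 1] by (simp add: is_3AP_def)
  moreover have "f x = f a \<or> f x = f (a + 1)" if "x \<in> B" for x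
  proof (cases "x mod 2 = a mod 2")
    case True
    then show ?thesis using same[OF that a(1)] by simp
  next
    case False
    then have "x mod 2 = (a + 1) mod 2" by presburger
    then show ?thesis using same[OF that a(2)] by simp
  qed
  ultimately show ?thesis using assms(5,6) by metis
qed

section \<open>Counting choices from lists of two colours\<close>

lemma rainbow_choice_of_two_sets:
  fixes P Q R :: "'a set"
  assumes "card P = 2" "card Q = 2" "card R = 2" "\<not> (P = Q \<and> Q = R)"
  shows "\<exists>u\<in>P. \<exists>v\<in>Q. \<exists>w\<in>R. u \<noteq> v \<and> v \<noteq> w \<and> u \<noteq> w"
proof -
  have other: "\<exists>v\<in>S. v \<noteq> w" if "card S = 2" for S and w :: 'a
    using that by (metis card_2_iff insertCI)
  have diff: "\<exists>u\<in>S. u \<notin> T" if "card S = 2" "card T = 2" "S \<noteq> T" for S T :: "'a set"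
    using that by (metis card_subset_eq card_ge_0_finite subsetI zero_less_numeral)
  show ?thesis
  proof (cases "P = Q")
    case False
    \<comment> \<open>Fixing first a colour that the other list lacks leaves two choices, each with
      a single colour to avoid.\<close>
    then obtain u where u: "u \<in> P" "u \<notin> Q" using diff[OF assms(1,2)] by blast
    obtain w where w: "w \<in> R" "w \<noteq> u" using other[OF assms(3)] by blast
    obtain v where v: "v \<in> Q" "v \<noteq> w" using other[OF assms(2)] by blast
    have "u \<noteq> v" using u v by blast
    then show ?thesis using u(1) v w by metis
  next
    case True
    then obtain w where w: "w \<in> R" "w \<notin> Q" using diff[OF assms(3,2)] assms(4) by blast
    obtain u where u: "u \<in> P" using other[OF assms(1)] by blast
    obtain v where v: "v \<in> Q" "v \<noteq> u" using other[OF assms(2)] by blast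
    have "u \<noteq> w" "v \<noteq> w" using u v w True by blast+
    then show ?thesis using u v w(1) by metis
  qed
qed

lemma prod_card_le_power:
  assumes "finite A" "\<And>x. card (L x) \<le> 2"
  shows "(\<Prod>x\<in>A. card (L x)) \<le> 2 ^ card {x\<in>A. card (L x) = 2}"
proof -
  have "(\<Prod>x\<in>A. card (L x)) \<le> (\<Prod>x\<in>A. if card (L x) = 2 then 2 else 1)"
  proof (rule prod_mono)
    fix x
    show "0 \<le> card (L x) \<and> card (L x) \<le> (if card (L x) = 2 then 2 else 1)"
      using assms(2)[of x] by auto
  qed
  also have "\<dots> = (\<Prod>x\<in>{x\<in>A. card (L x) = 2}. 2)"
    using assms(1) by (subst prod.inter_filter) auto
  finally show ?thesis by simp
qed

text \<open>Each of the disjoint pairs has four patterns, and the pattern \<open>u\<close>,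
  \<open>v\<close> violates its equality.\<close>

lemma card_PiE_equal_pairs:
  assumes "finite A" "\<And>x. finite (L x) \<and> card (L x) \<le> 2" "finite D" "B \<subseteq> A"
    and L: "\<And>x. x \<in> B \<Longrightarrow> L x = P" and "card P = 2"
    and yz: "\<And>d. d \<in> D \<Longrightarrow> y d \<in> B \<and> z d \<in> B"
    and "inj_on y D" "inj_on z D" "\<And>d e. d \<in> D \<Longrightarrow> e \<in> D \<Longrightarrow> y d \<noteq> z e"
  shows "real (card {c\<in>PiE A L. \<forall>d\<in>D. c (y d) = c (z d)}) \<le> (3 / 4) ^ card D * 2 ^ card A"
proof -
  obtain u v where uv: "P = {u, v}" "u \<noteq> v" using \<open>card P = 2\<close> by (metis card_2_iff)
  let ?b = "\<lambda>d. {y d, z d}"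
  let ?\<psi> = "\<lambda>d. restrict (\<lambda>t. if t = y d then u else v) (?b d)"
  have "{c\<in>PiE A L. \<forall>d\<in>D. c (y d) = c (z d)} \<subseteq> {c\<in>PiE A L. \<forall>d\<in>D. restrict c (?b d) \<noteq> ?\<psi> d}"
  proof
    fix c assume c: "c \<in> {c\<in>PiE A L. \<forall>d\<in>D. c (y d) = c (z d)}"
    have "restrict c (?b d) \<noteq> ?\<psi> d" if d: "d \<in> D" for d
    proof
      assume eq: "restrict c (?b d) = ?\<psi> d"
      have "y d \<noteq> z d" using assms(10) d by blast
      then have "c (y d) = u" "c (z d) = v"
        using fun_cong[OF eq, of "y d"] fun_cong[OF eq, of "z d"] by auto
      then show False using c d uv by auto
    qed
    then show "c \<in> {c\<in>PiE A L. \<forall>d\<in>D. restrict c (?b d) \<noteq> ?\<psi> d}" using c by blast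
  qed
  then have "card {c\<in>PiE A L. \<forall>d\<in>D. c (y d) = c (z d)} \<le> card {c\<in>PiE A L. \<forall>d\<in>D. restrict c (?b d) \<noteq> ?\<psi> d}"
    using assms(1,2) by (intro card_mono) (auto intro: finite_subset[OF _ finite_PiE[of A L]])
  then have "real (card {c\<in>PiE A L. \<forall>d\<in>D. c (y d) = c (z d)}) \<le> real (card {c\<in>PiE A L. \<forall>d\<in>D. restrict c (?b d) \<noteq> ?\<psi> d})"
    by (rule of_nat_mono)
  also have "\<dots> \<le> (1 - 1 / 4) ^ card D * real (\<Prod>x\<in>A. card (L x))"
  proof (rule card_PiE_avoiding_blocks)
    show "?b d \<inter> ?b e = {}" if "d \<in> D" "e \<in> D" "d \<noteq> e" for d e
      using that assms(8-10) by (auto dest: inj_onD)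
    show "?b d \<subseteq> A" if "d \<in> D" for d using yz[OF that] \<open>B \<subseteq> A\<close> by auto
    show "?\<psi> d \<in> PiE (?b d) L" if "d \<in> D" for d using yz[OF that] L uv by auto
    show "real (\<Prod>x\<in>?b d. card (L x)) \<le> 4" if "d \<in> D" for d
    proof -
      have "y d \<noteq> z d" using assms(10) that by blast
      then show ?thesis using yz[OF that] L \<open>card P = 2\<close> by simp
    qed
  qed (use assms in auto)
  also have "\<dots> \<le> (3 / 4) ^ card D * 2 ^ card A"
  proof -
    have "(\<Prod>x\<in>A. card (L x)) \<le> (\<Prod>x\<in>A. 2)" using assms(2) by (intro prod_mono) auto
    then have "real (\<Prod>x\<in>A. card (L x)) \<le> real (2 ^ card A)" by (intro of_nat_mono) simp
    then show ?thesis by (intro mult_mono) (auto intro: prod_nonneg)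
  qed
  finally show ?thesis .
qed

text \<open>If the colour of \<open>v\<close> is outside \<open>P\<close>, it differs from those of
  \<open>y d\<close> and \<open>z d\<close>, which lie in \<open>P\<close>. A progression through
  \<open>v\<close>, \<open>y d\<close> and \<open>z d\<close> that is not rainbow then forces
  \<open>c (y d) = c (z d)\<close>.\<close>

lemma card_PiE_off_palette_le:
  assumes A: "A \<subseteq> {1..n}" and L: "\<And>x. finite (L x) \<and> card (L x) \<le> 2"
    and B: "B \<subseteq> A" "\<And>x. x \<in> B \<Longrightarrow> L x = P" and "card P = 2"
    and missing: "real (card ({1..n} - B)) \<le> real n / 100" and n: "n \<ge> 400" and "v \<in> A"
  shows "real (card {c\<in>PiE A L. rainbow_3AP_free A c \<and> c v \<notin> P}) \<le> (3 / 4) powr (real n / 20) * 2 ^ n"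
proof -
  \<comment> \<open>The upper end of this range is less than twice each of its members, so no
    \<open>y d\<close> equals a \<open>z e\<close> and the pairs are disjoint. The progressions lead
    away from the nearer end of \<open>{1..n}\<close>, which keeps them inside.\<close>
  let ?J = "{n div 8<..n div 4}"
  define y where "y = (\<lambda>d. if v \<le> n div 2 then v + d else v - d)"
  define z where "z = (\<lambda>d. if v \<le> n div 2 then v + 2 * d else v - 2 * d)"
  let ?D = "{d\<in>?J. y d \<in> B \<and> z d \<in> B}"
  have v: "1 \<le> v" "v \<le> n" using A \<open>v \<in> A\<close> by auto
  have yz: "y d \<in> {1..n} \<and> z d \<in> {1..n}" if "d \<in> ?J" for d
    using that v by (auto simp: y_def z_def)
  have inj: "inj_on y ?J" "inj_on z ?J"
  proof -
    show "inj_on y ?J"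
    proof (rule inj_onI)
      fix d e assume "d \<in> ?J" "e \<in> ?J" "y d = y e"
      then show "d = e" unfolding y_def by (cases "v \<le> n div 2") auto
    qed
    show "inj_on z ?J"
    proof (rule inj_onI)
      fix d e assume "d \<in> ?J" "e \<in> ?J" "z d = z e"
      then show "d = e" unfolding z_def by (cases "v \<le> n div 2") auto
    qed
  qed
  have ne: "y d \<noteq> z e" if "d \<in> ?J" "e \<in> ?J" for d e
  proof -
    have "d < 2 * e" "2 * e \<le> n div 2" using that by auto
    then show ?thesis by (auto simp: y_def z_def)
  qed
  have "n div 4 - n div 8 = card ?J" by simp
  also have "\<dots> \<le> card (?D \<union> {d\<in>?J. y d \<in> {1..n} - B} \<union> {d\<in>?J. z d \<in> {1..n} - B})"
    by (rule card_mono) (use yz in auto)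
  also have "\<dots> \<le> card ?D + card {d\<in>?J. y d \<in> {1..n} - B} + card {d\<in>?J. z d \<in> {1..n} - B}"
    by (intro order.trans[OF card_Un_le] add_mono order_refl)
  also have "card {d\<in>?J. y d \<in> {1..n} - B} \<le> card ({1..n} - B)"
    by (rule card_inj_on_le[OF inj_on_subset[OF inj(1)]]) auto
  also have "card {d\<in>?J. z d \<in> {1..n} - B} \<le> card ({1..n} - B)"
    by (rule card_inj_on_le[OF inj_on_subset[OF inj(2)]]) auto
  \<comment> \<open>About \<open>n / 8\<close> differences, of which at most
    \<open>2 * n / 100\<close> lead to a missing point.\<close>
  finally have D: "real n / 20 \<le> real (card ?D)" using missing n by linarith
  have finA: "finite A" using A finite_subset by blast
  have fin: "finite (PiE A L)" by (rule finite_PiE) (use finA L in auto)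
  have "{c\<in>PiE A L. rainbow_3AP_free A c \<and> c v \<notin> P} \<subseteq> {c\<in>PiE A L. \<forall>d\<in>?D. c (y d) = c (z d)}"
  proof
    fix c assume c: "c \<in> {c\<in>PiE A L. rainbow_3AP_free A c \<and> c v \<notin> P}"
    have "c (y d) = c (z d)" if d: "d \<in> ?D" for d
    proof -
      have memB: "y d \<in> B" "z d \<in> B" using d by auto
      then have memA: "y d \<in> A" "z d \<in> A" using B(1) by auto
      have "c \<in> PiE A L" using c by blast
      then have "c (y d) \<in> P" "c (z d) \<in> P"
        using PiE_mem[OF _ memA(1)] PiE_mem[OF _ memA(2)] B(2)[OF memB(1)] B(2)[OF memB(2)] by blast+
      note mem = this memA
      show ?thesis
      proof (cases "v \<le> n div 2")
        case True
        then have "is_3AP A v d" using mem \<open>v \<in> A\<close> d by (auto simp: is_3AP_def y_def z_def)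
        then have "\<not> rainbow_3AP c v d" using c by (auto simp: rainbow_3AP_free_def)
        then show ?thesis using True c mem(1,2) by (auto simp: rainbow_3AP_def y_def z_def)
      next
        case False
        have "2 * d \<le> v" using False d by auto
        then have eq: "z d + d = y d" "z d + 2 * d = v" using False by (auto simp: y_def z_def)
        then have "is_3AP A (z d) d" using mem \<open>v \<in> A\<close> d by (auto simp: is_3AP_def)
        then have "\<not> rainbow_3AP c (z d) d" using c by (auto simp: rainbow_3AP_free_def)
        then show ?thesis using c mem(1,2) by (auto simp: rainbow_3AP_def eq)
      qed
    qed
    then show "c \<in> {c\<in>PiE A L. \<forall>d\<in>?D. c (y d) = c (z d)}" using c by blast
  qed
  then have "card {c\<in>PiE A L. rainbow_3AP_free A c \<and> c v \<notin> P} \<le> card {c\<in>PiE A L. \<forall>d\<in>?D. c (y d) = c (z d)}"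
    by (rule card_mono[rotated]) (use fin in simp)
  then have "real (card {c\<in>PiE A L. rainbow_3AP_free A c \<and> c v \<notin> P}) \<le> real (card {c\<in>PiE A L. \<forall>d\<in>?D. c (y d) = c (z d)})"
    by (rule of_nat_mono)
  also have "\<dots> \<le> (3 / 4) ^ card ?D * 2 ^ card A"
  proof (rule card_PiE_equal_pairs[OF finA L _ B \<open>card P = 2\<close>])
    show "inj_on y ?D" by (rule inj_on_subset[OF inj(1)]) blast
    show "inj_on z ?D" by (rule inj_on_subset[OF inj(2)]) blast
    show "y d \<noteq> z e" if "d \<in> ?D" "e \<in> ?D" for d e using ne that by blast
  qed auto
  also have "\<dots> \<le> (3 / 4) powr (real n / 20) * 2 ^ n"
  proof (rule mult_mono)
    have "(3 / 4 :: real) ^ card ?D = (3 / 4) powr real (card ?D)" by (simp add: powr_realpow)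
    also have "\<dots> \<le> (3 / 4) powr (real n / 20)" by (rule powr_mono'[OF D]) auto
    finally show "(3 / 4 :: real) ^ card ?D \<le> (3 / 4) powr (real n / 20)" .
    show "(2 :: real) ^ card A \<le> 2 ^ n" using card_mono[OF _ A] by (intro power_increasing) auto
  qed auto
  finally show ?thesis .
qed

lemma card_three_coloured_le:
  "\<exists>n0. \<forall>n\<ge>n0. \<forall>A\<subseteq>{1..n}. \<forall>L :: nat \<Rightarrow> nat set. (\<forall>x. finite (L x) \<and> card (L x) \<le> 2) \<longrightarrow>
    real (card {c\<in>PiE A L. rainbow_3AP_free A c \<and> card (c ` A) \<ge> 3}) \<le> (7 / 8) powr (real n / 400) * 2 ^ n"
proof -
  \<comment> \<open>Splits \<open>3 / 4\<close> as \<open>6 / 7\<close> times \<open>7 / 8\<close>: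
    the first factor absorbs the sum over at most \<open>n\<close> points \<open>v\<close>, the
    second gives the claimed bound.\<close>
  define \<rho> :: real where "\<rho> = (6 / 7) powr (1 / 20)"
  have "0 \<le> \<rho>" "\<rho> < 1" using powr_less_mono2[of "1 / 20" "6 / 7 :: real" 1] by (auto simp: \<rho>_def)
  from eventually_linear_times_power_less[OF this, of 1] obtain n1 where
    n1: "\<And>n. n \<ge> n1 \<Longrightarrow> real n * \<rho> ^ n < 1" by auto
  have main: "real (card {c\<in>PiE A L. rainbow_3AP_free A c \<and> card (c ` A) \<ge> 3}) \<le> (7 / 8) powr (real n / 400) * 2 ^ n"
    if n: "n \<ge> max n1 400" and A: "A \<subseteq> {1..n}" and L: "\<forall>x. finite (L x) \<and> card (L x) \<le> 2"
    for n A and L :: "nat \<Rightarrow> nat set"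
  proof -
    have n': "n \<ge> n1" "n \<ge> 400" using n by auto
    let ?C = "{c\<in>PiE A L. rainbow_3AP_free A c \<and> card (c ` A) \<ge> 3}"
    have finA: "finite A" using A finite_subset by blast
    have fin: "finite (PiE A L)" by (rule finite_PiE) (use finA L in auto)
    define A' where "A' = {x\<in>A. card (L x) = 2}"
    have A': "A' \<subseteq> A" "A' \<subseteq> {1..n}" "finite A'" using A finA by (auto simp: A'_def)
    have prod: "real (\<Prod>x\<in>A. card (L x)) \<le> 2 ^ card A'"
      using of_nat_mono[OF prod_card_le_power[OF finA, of L], where 'a = real] L by (simp add: A'_def)
    define F where "F = {(a, d). is_3AP A' a d \<and> \<not> (L a = L (a + d) \<and> L (a + d) = L (a + 2 * d))}"
    let ?b = "\<lambda>(a, d). {a, a + d, a + 2 * d :: nat}"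
    have "finite F"
      by (rule finite_subset[of _ "{1..n} \<times> {1..n}"]) (use A'(2) in \<open>fastforce simp: is_3AP_def F_def\<close>, simp)
    from exists_maximal_disjoint_subfamily[OF this, of ?b] obtain I where I: "I \<subseteq> F"
      and disj: "\<forall>i\<in>I. \<forall>j\<in>I. i \<noteq> j \<longrightarrow> ?b i \<inter> ?b j = {}"
      and max: "\<forall>i\<in>F. ?b i \<inter> (\<Union>j\<in>I. ?b j) = {} \<longrightarrow> i \<in> I"
      by (elim exE conjE)
    have finI: "finite I" using I \<open>finite F\<close> finite_subset by blast
    \<comment> \<open>The threshold \<open>n / 400\<close>: in the last case \<open>B\<close> misses
      fewer than \<open>n / 400\<close> points outside \<open>A'\<close> and fewer than
      \<open>3 * n / 400\<close> in the blocks, together less than \<open>n / 100\<close>.\<close>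
    consider "real (card A') \<le> real n - real n / 400" | "real (card I) \<ge> real n / 400" |
      "real (card A') > real n - real n / 400" "real (card I) < real n / 400" by linarith
    then show ?thesis
    proof cases
      case 1
      have "card ?C \<le> card (PiE A L)" by (rule card_mono[OF fin]) auto
      then have "real (card ?C) \<le> real (\<Prod>x\<in>A. card (L x))" using finA by (simp only: card_PiE of_nat_mono)
      also have "\<dots> \<le> 2 powr real (card A')" using prod by (simp add: powr_realpow)
      also have "\<dots> \<le> 2 powr (real n - real n / 400)" using 1 by simp
      also have "\<dots> = 2 powr real n / 2 powr (real n / 400)" by (rule powr_diff)
      also have "\<dots> = (1 / 2) powr (real n / 400) * 2 ^ n"
        by (simp add: powr_divide powr_realpow)
      also have "\<dots> \<le> (7 / 8) powr (real n / 400) * 2 ^ n"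
        by (intro mult_right_mono powr_mono2) auto
      finally show ?thesis .
    next
      case 2
      \<comment> \<open>The lists of each progression in \<open>I\<close> admit a rainbow pattern,
        which a rainbow-free colouring must avoid on that block.\<close>
      have "\<forall>i\<in>I. \<exists>f. f \<in> PiE (?b i) L \<and> rainbow_3AP f (fst i) (snd i)"
      proof
        fix i assume i: "i \<in> I"
        obtain a d where ad: "i = (a, d)" by (cases i)
        have "(a, d) \<in> F" using i I ad by blast
        then have "\<not> (L a = L (a + d) \<and> L (a + d) = L (a + 2 * d))" "card (L a) = 2" "card (L (a + d)) = 2"
          "card (L (a + 2 * d)) = 2" "d \<ge> 1"
          by (auto simp: F_def is_3AP_def A'_def)
        then obtain u v w where uvw: "u \<in> L a" "v \<in> L (a + d)" "w \<in> L (a + 2 * d)" "u \<noteq> v" "v \<noteq> w" "u \<noteq> w" "d \<ge> 1"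
          using rainbow_choice_of_two_sets[of "L a" "L (a + d)" "L (a + 2 * d)"] by blast
        let ?f = "restrict (\<lambda>t. if t = a then u else if t = a + d then v else w) {a, a + d, a + 2 * d}"
        have "rainbow_3AP ?f a d" unfolding rainbow_3AP_def using uvw(4-7) by simp
        moreover have "?f \<in> PiE {a, a + d, a + 2 * d} L"
          unfolding restrict_PiE_iff using uvw(1-3,7) by simp
        ultimately have "?f \<in> PiE (?b i) L \<and> rainbow_3AP ?f (fst i) (snd i)" by (simp add: ad)
        then show "\<exists>f. f \<in> PiE (?b i) L \<and> rainbow_3AP f (fst i) (snd i)" by (rule exI[of _ ?f])
      qed
      from bchoice[OF this] obtain \<psi> where \<psi>: "\<forall>i\<in>I. \<psi> i \<in> PiE (?b i) L \<and> rainbow_3AP (\<psi> i) (fst i) (snd i)"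
        by (elim exE)
      have "?C \<subseteq> {c\<in>PiE A L. \<forall>i\<in>I. restrict c (?b i) \<noteq> \<psi> i}"
      proof
        fix c assume c: "c \<in> ?C"
        have "restrict c (?b i) \<noteq> \<psi> i" if "i \<in> I" for i
        proof
          assume eq: "restrict c (?b i) = \<psi> i"
          obtain a d where i: "i = (a, d)" by (cases i)
          have AP: "is_3AP A a d" using that I A'(1) by (auto simp: i F_def is_3AP_def)
          have "rainbow_3AP (restrict c (?b i)) a d" using \<psi> that eq i by auto
          then have "rainbow_3AP c a d" by (simp add: rainbow_3AP_def i)
          then show False using c AP by (auto simp: rainbow_3AP_free_def)
        qed
        then show "c \<in> {c\<in>PiE A L. \<forall>i\<in>I. restrict c (?b i) \<noteq> \<psi> i}" using c by blast
      qed
      then have "card ?C \<le> card {c\<in>PiE A L. \<forall>i\<in>I. restrict c (?b i) \<noteq> \<psi> i}"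
        by (rule card_mono[rotated]) (use fin in simp)
      then have "real (card ?C) \<le> real (card {c\<in>PiE A L. \<forall>i\<in>I. restrict c (?b i) \<noteq> \<psi> i})"
        by (rule of_nat_mono)
      also have "\<dots> \<le> (1 - 1 / 8) ^ card I * real (\<Prod>x\<in>A. card (L x))"
      proof (rule card_PiE_avoiding_blocks)
        fix i assume i: "i \<in> I"
        obtain a d where ad: "i = (a, d)" by (cases i)
        have AP: "is_3AP A' a d" using i I by (auto simp: ad F_def)
        then have mem: "a \<in> A'" "a + d \<in> A'" "a + 2 * d \<in> A'" "d \<ge> 1" by (auto simp: is_3AP_def)
        then show "?b i \<subseteq> A" using A'(1) by (auto simp: ad)
        show "\<psi> i \<in> PiE (?b i) L" by (rule conjunct1[OF bspec[OF \<psi> i]])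
        show "real (\<Prod>x\<in>?b i. card (L x)) \<le> 8" using mem by (simp add: ad A'_def)
      next
        show "?b i \<inter> ?b j = {}" if "i \<in> I" "j \<in> I" "i \<noteq> j" for i j
          using disj that by simp
      qed (use finA finI L in auto)
      also have "\<dots> \<le> (7 / 8) powr (real n / 400) * 2 ^ n"
      proof (rule mult_mono)
        have "(1 - 1 / 8 :: real) ^ card I = (7 / 8) powr real (card I)" by (simp add: powr_realpow)
        also have "\<dots> \<le> (7 / 8) powr (real n / 400)" by (rule powr_mono'[OF 2]) auto
        finally show "(1 - 1 / 8 :: real) ^ card I \<le> (7 / 8) powr (real n / 400)" .
        have "(2 :: real) ^ card A' \<le> 2 ^ n" using card_mono[OF _ A'(2)] by (intro power_increasing) auto
        then show "real (\<Prod>x\<in>A. card (L x)) \<le> 2 ^ n" using prod by linarith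
      qed (auto intro: prod_nonneg)
      finally show ?thesis .
    next
      case 3
      define B where "B = A' - (\<Union>i\<in>I. ?b i)"
      have B: "B \<subseteq> A'" "B \<subseteq> A" "B \<subseteq> {1..n}" using A' by (auto simp: B_def)
      have missing: "real (card ({1..n} - B)) \<le> real n / 100"
      proof -
        have finb: "finite (\<Union>i\<in>I. ?b i)" using finI by auto
        have "card ({1..n} - B) \<le> card (({1..n} - A') \<union> (\<Union>i\<in>I. ?b i))"
          by (rule card_mono) (use finb in \<open>auto simp: B_def\<close>)
        also have "\<dots> \<le> card ({1..n} - A') + card (\<Union>i\<in>I. ?b i)" by (rule card_Un_le)
        also have "card (\<Union>i\<in>I. ?b i) \<le> (\<Sum>i\<in>I. card (?b i))" by (rule card_UN_le[OF finI])
        also have "\<dots> \<le> (\<Sum>i\<in>I. 3)" by (rule sum_mono) (auto simp: card_insert_if)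
        finally have "real (card ({1..n} - B)) \<le> real (card ({1..n} - A')) + 3 * real (card I)" by simp
        moreover have "card ({1..n} - A') = n - card A'" using A' by (simp add: card_Diff_subset)
        ultimately show ?thesis using 3 by linarith
      qed
      \<comment> \<open>A progression inside \<open>B\<close> meets no block of \<open>I\<close>;
        were its lists different, maximality would put it into \<open>I\<close>.\<close>
      have const: "L a = L (a + d) \<and> L (a + d) = L (a + 2 * d)" if AP: "is_3AP B a d" for a d
      proof (rule ccontr)
        assume ne: "\<not> ?thesis"
        have "is_3AP A' a d" using AP B(1) by (auto simp: is_3AP_def)
        then have "(a, d) \<in> F" using ne by (simp add: F_def)
        moreover have "?b (a, d) \<inter> (\<Union>i\<in>I. ?b i) = {}" using AP unfolding is_3AP_def B_def by blast
        ultimately have "(a, d) \<in> I" by (rule max[rule_format])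
        then show False using \<open>?b (a, d) \<inter> (\<Union>i\<in>I. ?b i) = {}\<close> by blast
      qed
      have "B \<noteq> {}" using missing n' by auto
      then obtain b0 where b0: "b0 \<in> B" by blast
      let ?P = "L b0"
      have LB: "L x = ?P" if "x \<in> B" for x
        by (rule constant_of_constant_on_3APs[OF B(3) missing _ const that b0]) (use n' in auto)
      have cP: "card ?P = 2" using b0 B(1) by (auto simp: A'_def)
      let ?E = "\<lambda>v. {c\<in>PiE A L. rainbow_3AP_free A c \<and> c v \<notin> ?P}"
      have "?C \<subseteq> (\<Union>v\<in>A. ?E v)"
      proof
        fix c assume c: "c \<in> ?C"
        have "\<not> c ` A \<subseteq> ?P"
        proof
          assume "c ` A \<subseteq> ?P"
          then have "card (c ` A) \<le> 2" using card_mono[of ?P "c ` A"] cP L by auto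
          then show False using c by simp
        qed
        then show "c \<in> (\<Union>v\<in>A. ?E v)" using c by blast
      qed
      then have "card ?C \<le> card (\<Union>v\<in>A. ?E v)"
        by (rule card_mono[rotated]) (use fin finA in auto)
      also have "\<dots> \<le> (\<Sum>v\<in>A. card (?E v))" by (rule card_UN_le[OF finA])
      finally have "real (card ?C) \<le> real (\<Sum>v\<in>A. card (?E v))" by (rule of_nat_mono)
      also have "\<dots> = (\<Sum>v\<in>A. real (card (?E v)))" by simp
      also have "\<dots> \<le> (\<Sum>v\<in>A. (3 / 4) powr (real n / 20) * 2 ^ n)"
        by (rule sum_mono, rule card_PiE_off_palette_le[OF A _ B(2) LB cP missing n'(2)]) (use L in auto)
      also have "\<dots> = real (card A) * ((3 / 4) powr (real n / 20) * 2 ^ n)" by simp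
      also have "\<dots> \<le> real n * ((3 / 4) powr (real n / 20) * 2 ^ n)"
        using card_mono[OF _ A] by (intro mult_right_mono) auto
      also have "(3 / 4 :: real) powr (real n / 20) = (6 / 7) powr (real n / 20) * (7 / 8) powr (real n / 20)"
        by (simp add: powr_mult[symmetric])
      also have "(6 / 7 :: real) powr (real n / 20) = \<rho> ^ n"
        by (simp add: \<rho>_def powr_power)
      also have "real n * (\<rho> ^ n * (7 / 8) powr (real n / 20) * 2 ^ n) = (real n * \<rho> ^ n) * ((7 / 8) powr (real n / 20) * 2 ^ n)"
        by simp
      also have "\<dots> \<le> 1 * ((7 / 8) powr (real n / 400) * 2 ^ n)"
      proof (rule mult_mono)
        show "(7 / 8) powr (real n / 20) * 2 ^ n \<le> (7 / 8) powr (real n / 400) * (2 :: real) ^ n"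
          by (intro mult_right_mono powr_mono') auto
      qed (use n1[OF n'(1)] in auto)
      finally show ?thesis by simp
    qed
  qed
  show ?thesis by (intro exI[of _ "max n1 400"] allI impI main) auto
qed

section \<open>Comparison with two-coloured colourings\<close>

lemma powr_linear_eventually_less:
  fixes q k e :: real
  assumes "0 < q" "q < 1" "e > 0" "k > 0"
  shows "\<exists>n0::nat. \<forall>n\<ge>n0. q powr (real n / k) < e"
proof -
  define \<rho> where "\<rho> = q powr (1 / k)"
  have \<rho>: "0 < \<rho>" "\<rho> < 1" using assms powr_less_mono2[of "1 / k" q 1] by (auto simp: \<rho>_def)
  then obtain n0 where n0: "\<rho> ^ n0 < e" using real_arch_pow_inv[of e \<rho>] assms(3) by blast
  have "q powr (real n / k) < e" if "n \<ge> n0" for n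
  proof -
    have "q powr (real n / k) = \<rho> ^ n" using assms(1) by (simp add: \<rho>_def powr_power)
    also have "\<dots> \<le> \<rho> ^ n0" using \<rho> that by (intro power_decreasing) auto
    finally show ?thesis using n0 by simp
  qed
  then show ?thesis by blast
qed

lemma rainbow_3AP_free_of_two_colours:
  assumes "card (c ` A) \<le> 2" "finite A"
  shows "rainbow_3AP_free A c"
  unfolding rainbow_3AP_free_def
proof (intro allI impI notI)
  fix a d assume "is_3AP A a d" "rainbow_3AP c a d"
  then have "{c a, c (a + d), c (a + 2 * d)} \<subseteq> c ` A" "card {c a, c (a + d), c (a + 2 * d)} = 3"
    by (auto simp: is_3AP_def rainbow_3AP_def)
  then show False using card_mono[of "c ` A" "{c a, c (a + d), c (a + 2 * d)}"] assms by simp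
qed

text \<open>Only the two constant maps fail to use both colours. Demanding both makes the families
  of different pairs disjoint in the count below.\<close>

lemma card_surjective_on_pair_ge:
  assumes "finite A" "A \<noteq> {}" "card P = 2"
  shows "2 ^ card A \<le> card {c\<in>A \<rightarrow>\<^sub>E P. c ` A = P} + 2"
proof -
  obtain u v where uv: "P = {u, v}" "u \<noteq> v" using \<open>card P = 2\<close> by (metis card_2_iff)
  have fin: "finite (A \<rightarrow>\<^sub>E P)" using assms(1) uv by (intro finite_PiE) auto
  have "A \<rightarrow>\<^sub>E P \<subseteq> {c\<in>A \<rightarrow>\<^sub>E P. c ` A = P} \<union> {\<lambda>x\<in>A. u, \<lambda>x\<in>A. v}"
  proof
    fix c assume c: "c \<in> A \<rightarrow>\<^sub>E P"
    have "c = (\<lambda>x\<in>A. w)" if "\<And>x. x \<in> A \<Longrightarrow> c x = w" for w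
    proof
      fix x
      show "c x = (\<lambda>x\<in>A. w) x" using that[of x] PiE_arb[OF c, of x] by (cases "x \<in> A") simp_all
    qed
    moreover have "c ` A = P" if "x \<in> A" "c x \<noteq> u" "y \<in> A" "c y \<noteq> v" for x y
    proof -
      have "c x \<in> {u, v}" "c y \<in> {u, v}" using PiE_mem[OF c] that uv(1) by blast+
      then have "c x = v" "c y = u" using that by auto
      then have "u \<in> c ` A" "v \<in> c ` A" using that by blast+
      moreover have "c ` A \<subseteq> P" using PiE_mem[OF c] by blast
      ultimately show ?thesis using uv by blast
    qed
    ultimately show "c \<in> {c\<in>A \<rightarrow>\<^sub>E P. c ` A = P} \<union> {\<lambda>x\<in>A. u, \<lambda>x\<in>A. v}" using c by blast
  qed
  then have "card (A \<rightarrow>\<^sub>E P) \<le> card ({c\<in>A \<rightarrow>\<^sub>E P. c ` A = P} \<union> {\<lambda>x\<in>A. u, \<lambda>x\<in>A. v})"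
    by (rule card_mono[rotated]) (use fin in auto)
  also have "\<dots> \<le> card {c\<in>A \<rightarrow>\<^sub>E P. c ` A = P} + card {\<lambda>x\<in>A. u, \<lambda>x\<in>A. v}" by (rule card_Un_le)
  also have "card {\<lambda>x\<in>A. u, \<lambda>x\<in>A. v} \<le> 2" by (simp add: card_insert_if)
  finally show ?thesis using assms(1,3) by (simp add: card_PiE)
qed

definition colour_pairs :: "nat \<Rightarrow> nat set set" where
  "colour_pairs r = {P. P \<subseteq> {1..r} \<and> card P = 2}"

lemma finite_colour_pairs: "finite (colour_pairs r)"
  unfolding colour_pairs_def by (rule finite_subset[of _ "Pow {1..r}"]) auto

lemma num_rainbow_free_interval_ge:
  assumes "n \<ge> 1"
  shows "card (colour_pairs r) * 2 ^ n \<le> num_rainbow_free r {1..n} + 2 * card (colour_pairs r)"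
proof -
  let ?G = "\<lambda>P. {c\<in>{1..n} \<rightarrow>\<^sub>E P. c ` {1..n} = P}"
  have finG: "finite (?G P)" if "P \<in> colour_pairs r" for P
    by (rule finite_subset[OF _ finite_PiE[of "{1..n}" "\<lambda>_. P"]])
      (use that finite_subset in \<open>auto simp: colour_pairs_def\<close>)
  have "card (colour_pairs r) * 2 ^ n = (\<Sum>P\<in>colour_pairs r. 2 ^ n)" by simp
  also have "\<dots> \<le> (\<Sum>P\<in>colour_pairs r. card (?G P) + 2)"
    by (rule sum_mono) (use card_surjective_on_pair_ge[of "{1..n}"] assms in \<open>auto simp: colour_pairs_def\<close>)
  also have "\<dots> = (\<Sum>P\<in>colour_pairs r. card (?G P)) + 2 * card (colour_pairs r)"
    by (simp only: sum.distrib sum_constant of_nat_id mult.commute)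
  also have "(\<Sum>P\<in>colour_pairs r. card (?G P)) = card (\<Union>P\<in>colour_pairs r. ?G P)"
    by (rule card_UN_disjoint[symmetric]) (use finG finite_colour_pairs in auto)
  also have "card (\<Union>P\<in>colour_pairs r. ?G P) \<le> num_rainbow_free r {1..n}"
    unfolding num_rainbow_free_def
  proof (rule card_mono)
    show "finite {c \<in> colorings r {1..n}. rainbow_3AP_free {1..n} c}"
      unfolding colorings_def by (rule finite_subset[OF _ finite_PiE[of "{1..n}" "\<lambda>_. {1..r}"]]) auto
    show "(\<Union>P\<in>colour_pairs r. ?G P) \<subseteq> {c \<in> colorings r {1..n}. rainbow_3AP_free {1..n} c}"
    proof
      fix c assume "c \<in> (\<Union>P\<in>colour_pairs r. ?G P)"
      then obtain P where P: "P \<subseteq> {1..r}" "card P = 2" "c \<in> {1..n} \<rightarrow>\<^sub>E P" "c ` {1..n} = P"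
        by (auto simp: colour_pairs_def)
      then have "c \<in> {1..n} \<rightarrow>\<^sub>E {1..r}" using PiE_mono[of "{1..n}" "\<lambda>_. P" "\<lambda>_. {1..r}"] by blast
      moreover have "rainbow_3AP_free {1..n} c"
        by (rule rainbow_3AP_free_of_two_colours) (use P in auto)
      ultimately show "c \<in> {c \<in> colorings r {1..n}. rainbow_3AP_free {1..n} c}"
        by (simp add: colorings_def)
    qed
  qed
  finally show ?thesis by simp
qed

text \<open>The image of a colouring with at most two colours extends to a pair, as
  \<open>r \<ge> 2\<close>. Constant colourings may be counted repeatedly, which is harmless in an
  upper bound.\<close>

lemma num_rainbow_free_le:
  assumes "finite A" "r \<ge> 2"
  shows "num_rainbow_free r A \<le> card (colour_pairs r) * 2 ^ card A +
    card {c\<in>colorings r A. rainbow_3AP_free A c \<and> card (c ` A) \<ge> 3}"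
proof -
  let ?T = "{c\<in>colorings r A. rainbow_3AP_free A c \<and> card (c ` A) \<ge> 3}"
  have finP: "finite (A \<rightarrow>\<^sub>E P)" if "P \<in> colour_pairs r" for P
    using that assms(1) finite_subset[of P "{1..r}"] by (intro finite_PiE) (auto simp: colour_pairs_def)
  have finT: "finite ?T"
    unfolding colorings_def by (rule finite_subset[OF _ finite_PiE[of A "\<lambda>_. {1..r}"]]) (use assms in auto)
  have "{c\<in>colorings r A. rainbow_3AP_free A c} \<subseteq> (\<Union>P\<in>colour_pairs r. A \<rightarrow>\<^sub>E P) \<union> ?T"
  proof
    fix c assume c: "c \<in> {c\<in>colorings r A. rainbow_3AP_free A c}"
    show "c \<in> (\<Union>P\<in>colour_pairs r. A \<rightarrow>\<^sub>E P) \<union> ?T"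
    proof (cases "card (c ` A) \<ge> 3")
      case True
      then show ?thesis using c by blast
    next
      case False
      have "c ` A \<subseteq> {1..r}" using c by (auto simp: colorings_def)
      then obtain P where P: "c ` A \<subseteq> P" "P \<subseteq> {1..r}" "card P = 2"
        using exists_subset_between[of "c ` A" 2 "{1..r}"] False assms(2) by auto
      then have "c \<in> A \<rightarrow>\<^sub>E P" using c by (auto simp: colorings_def PiE_iff)
      then show ?thesis using P by (auto simp: colour_pairs_def)
    qed
  qed
  then have "num_rainbow_free r A \<le> card ((\<Union>P\<in>colour_pairs r. A \<rightarrow>\<^sub>E P) \<union> ?T)"
    unfolding num_rainbow_free_def
    by (rule card_mono[rotated]) (use finite_colour_pairs finP finT in auto)
  also have "\<dots> \<le> card (\<Union>P\<in>colour_pairs r. A \<rightarrow>\<^sub>E P) + card ?T" by (rule card_Un_le)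
  also have "card (\<Union>P\<in>colour_pairs r. A \<rightarrow>\<^sub>E P) \<le> (\<Sum>P\<in>colour_pairs r. card (A \<rightarrow>\<^sub>E P))"
    by (rule card_UN_le[OF finite_colour_pairs])
  also have "\<dots> = (\<Sum>P\<in>colour_pairs r. 2 ^ card A)"
    by (rule sum.cong) (use assms(1) in \<open>auto simp: card_PiE colour_pairs_def\<close>)
  finally show ?thesis by simp
qed

lemma card_three_coloured_rainbow_free_less:
  "\<exists>n0. \<forall>n\<ge>n0. \<forall>A\<subseteq>{1..n}.
    real (card {c\<in>colorings r A. rainbow_3AP_free A c \<and> card (c ` A) \<ge> 3}) < 2 ^ n / 16"
proof -
  \<comment> \<open>Makes \<open>2 powr (\<theta> * n)\<close> equal to
    \<open>(8 / 7) powr (n / 800)\<close>, half the saving in \<open>card_three_coloured_le\<close>,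
    so that a factor \<open>(7 / 8) powr (n / 800)\<close> survives.\<close>
  define \<theta> :: real where "\<theta> = log 2 (8 / 7) / 800"
  have "\<theta> > 0" by (simp add: \<theta>_def)
  obtain n1 where n1: "\<forall>n\<ge>n1. \<forall>A\<subseteq>{1..n}. \<exists>\<L> :: (nat \<Rightarrow> nat set) set.
    finite \<L> \<and> real (card \<L>) \<le> 2 powr (\<theta> * real n) \<and> (\<forall>L\<in>\<L>. \<forall>x. finite (L x) \<and> card (L x) \<le> 2) \<and>
    (\<forall>c\<in>colorings r A. rainbow_3AP_free A c \<longrightarrow> (\<exists>L\<in>\<L>. c \<in> PiE A L))"
    using exists_list_assignments[OF \<open>\<theta> > 0\<close>, of r] by (elim exE)
  obtain n2 where n2: "\<forall>n\<ge>n2. \<forall>A\<subseteq>{1..n}. \<forall>L :: nat \<Rightarrow> nat set. (\<forall>x. finite (L x) \<and> card (L x) \<le> 2) \<longrightarrow>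
    real (card {c\<in>PiE A L. rainbow_3AP_free A c \<and> card (c ` A) \<ge> 3}) \<le> (7 / 8) powr (real n / 400) * 2 ^ n"
    using card_three_coloured_le by (elim exE)
  obtain n3 where n3: "\<forall>n\<ge>n3. (7 / 8 :: real) powr (real n / 800) < 1 / 16"
    using powr_linear_eventually_less[of "7 / 8" "1 / 16" 800] by auto
  have main: "real (card {c\<in>colorings r A. rainbow_3AP_free A c \<and> card (c ` A) \<ge> 3}) < 2 ^ n / 16"
    if n: "n \<ge> max n1 (max n2 n3)" and A: "A \<subseteq> {1..n}" for n A
  proof -
    have n': "n \<ge> n1" "n \<ge> n2" "n \<ge> n3" using n by auto
    let ?T = "{c\<in>colorings r A. rainbow_3AP_free A c \<and> card (c ` A) \<ge> 3}"
    let ?E = "\<lambda>L. {c\<in>PiE A L. rainbow_3AP_free A c \<and> card (c ` A) \<ge> 3}"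
    obtain \<L> :: "(nat \<Rightarrow> nat set) set" where fin: "finite \<L>" and card: "real (card \<L>) \<le> 2 powr (\<theta> * real n)"
      and L: "\<forall>L\<in>\<L>. \<forall>x. finite (L x) \<and> card (L x) \<le> 2"
      and cover: "\<forall>c\<in>colorings r A. rainbow_3AP_free A c \<longrightarrow> (\<exists>L\<in>\<L>. c \<in> PiE A L)"
      using n1[rule_format, OF n'(1) A] by (elim exE conjE)
    have finA: "finite A" using A finite_subset by blast
    have finE: "finite (?E L)" if "L \<in> \<L>" for L
      by (rule finite_subset[OF _ finite_PiE[of A L]]) (use L that finA in auto)
    have "?T \<subseteq> (\<Union>L\<in>\<L>. ?E L)" using cover by blast
    then have "card ?T \<le> card (\<Union>L\<in>\<L>. ?E L)"
      by (rule card_mono[rotated]) (use fin finE in simp)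
    also have "\<dots> \<le> (\<Sum>L\<in>\<L>. card (?E L))" by (rule card_UN_le[OF fin])
    finally have "real (card ?T) \<le> real (\<Sum>L\<in>\<L>. card (?E L))" by (rule of_nat_mono)
    also have "\<dots> = (\<Sum>L\<in>\<L>. real (card (?E L)))" by simp
    also have "\<dots> \<le> (\<Sum>L\<in>\<L>. (7 / 8) powr (real n / 400) * 2 ^ n)"
      by (rule sum_mono, rule n2[rule_format, OF n'(2) A]) (use L in auto)
    also have "\<dots> = real (card \<L>) * ((7 / 8) powr (real n / 400) * 2 ^ n)" by simp
    also have "\<dots> \<le> 2 powr (\<theta> * real n) * ((7 / 8) powr (real n / 400) * 2 ^ n)"
      by (rule mult_right_mono[OF card]) simp
    also have "2 powr (\<theta> * real n) = (8 / 7) powr (real n / 800)"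
    proof -
      have "2 powr (\<theta> * real n) = (2 powr log 2 (8 / 7)) powr (real n / 800)"
        by (simp only: powr_powr \<theta>_def) simp
      then show ?thesis by simp
    qed
    also have "(7 / 8 :: real) powr (real n / 400) = (7 / 8) powr (real n / 800) * (7 / 8) powr (real n / 800)"
      by (simp add: powr_add[symmetric])
    also have "(8 / 7) powr (real n / 800) * ((7 / 8) powr (real n / 800) * (7 / 8) powr (real n / 800) * 2 ^ n)
        = ((8 / 7) powr (real n / 800) * (7 / 8) powr (real n / 800)) * (7 / 8 :: real) powr (real n / 800) * 2 ^ n"
      by (simp only: mult_ac)
    also have "(8 / 7 :: real) powr (real n / 800) * (7 / 8) powr (real n / 800) = 1"
      by (simp add: powr_mult[symmetric])
    also have "1 * (7 / 8 :: real) powr (real n / 800) * 2 ^ n < 1 * (1 / 16) * 2 ^ n"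
      using n3 n'(3) by (intro mult_strict_right_mono mult_strict_left_mono) auto
    finally show ?thesis by simp
  qed
  show ?thesis by (intro exI[of _ "max n1 (max n2 n3)"] allI impI main)
qed

theorem theorem1p4:
  shows "\<forall>r::nat. r \<ge> 3 \<longrightarrow>
    (\<exists>n1::nat. \<forall>n::nat. n \<ge> n1 \<longrightarrow>
      (\<forall>A. A \<subset> {1..n} \<longrightarrow> num_rainbow_free r A < num_rainbow_free r {1..n}))"
proof (intro allI impI)
  fix r :: nat assume r: "r \<ge> 3"
  obtain n0 where n0: "\<forall>n\<ge>n0. \<forall>A\<subseteq>{1..n}.
    real (card {c\<in>colorings r A. rainbow_3AP_free A c \<and> card (c ` A) \<ge> 3}) < 2 ^ n / 16"
    using card_three_coloured_rainbow_free_less[of r] by (elim exE)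
  have main: "num_rainbow_free r A < num_rainbow_free r {1..n}"
    if n: "n \<ge> max n0 4" and A: "A \<subset> {1..n}" for n A
  proof -
    define C where "C = card (colour_pairs r)"
    have "{1, 2} \<in> colour_pairs r" using r by (auto simp: colour_pairs_def)
    then have "C \<ge> 1" unfolding C_def
      using finite_colour_pairs[of r] by (metis card_gt_0_iff empty_iff less_eq_Suc_le One_nat_def)
    \<comment> \<open>Properness enters here: one missing point halves the two-coloured
      count.\<close>
    have "card A < card {1..n}" by (rule psubset_card_mono[OF _ A]) simp
    then have "(2 :: real) ^ card A \<le> 2 ^ (n - 1)" by (intro power_increasing) auto
    also have "\<dots> = 2 ^ n / 2" using n by (cases n) auto
    finally have pow: "(2 :: real) ^ card A \<le> 2 ^ n / 2" .
    let ?T = "{c\<in>colorings r A. rainbow_3AP_free A c \<and> card (c ` A) \<ge> 3}"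
    have "finite A" using A finite_subset by blast
    then have "num_rainbow_free r A \<le> C * 2 ^ card A + card ?T"
      unfolding C_def using r by (intro num_rainbow_free_le) auto
    then have "real (num_rainbow_free r A) \<le> real (C * 2 ^ card A + card ?T)" by (rule of_nat_mono)
    also have "\<dots> = real C * 2 ^ card A + real (card ?T)" by simp
    also have "\<dots> < real C * (2 ^ n / 2) + 2 ^ n / 16"
      using n0 n A pow by (intro add_le_less_mono mult_left_mono) auto
    \<comment> \<open>For \<open>n \<ge> 4\<close> and \<open>C \<ge> 1\<close>, the remaining half
      of \<open>C * 2 ^ n\<close> covers both \<open>2 ^ n / 16\<close> and the \<open>2 * C\<close>
      lost to constant colourings.\<close>
    also have "\<dots> \<le> real C * 2 ^ n - 2 * real C"
    proof -
      have "(2 :: real) ^ 4 \<le> 2 ^ n" using n by (intro power_increasing) auto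
      then have "1 * (2 ^ n / 16) \<le> real C * (2 ^ n / 2 - 2)"
        using \<open>C \<ge> 1\<close> by (intro mult_mono) auto
      then show ?thesis by (simp add: algebra_simps)
    qed
    also have "\<dots> \<le> real (num_rainbow_free r {1..n})"
    proof -
      have "C * 2 ^ n \<le> num_rainbow_free r {1..n} + 2 * C"
        unfolding C_def using n by (intro num_rainbow_free_interval_ge) auto
      then have "real (C * 2 ^ n) \<le> real (num_rainbow_free r {1..n} + 2 * C)" by (rule of_nat_mono)
      then show ?thesis by simp
    qed
    finally show ?thesis by simp
  qed
  show "\<exists>n1. \<forall>n\<ge>n1. \<forall>A\<subset>{1..n}. num_rainbow_free r A < num_rainbow_free r {1..n}"
    by (intro exI[of _ "max n0 4"] allI impI main)
qed

end
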